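(* Let $F$ be a fractal square and $H=F+\mathbb{Z}^2$, with complement $H^c=\mathbb{R}^2\setminus H$. Then $F$ satisfies either (i) $H^c$ has a bounded component, which is also equivalent to: $F$ contains a non-trivial component that is not a line segment; or (ii) $H^c$ has an unbounded component, and then $F$ is either totally disconnected or all non-trivial components of $F$ are parallel line segments.
   Context: Let $n\ge 2$ be an integer and let $\mathcal{D}\subset\{0,1,\dots,n-1\}^2$ be a digit set with $1<\#\mathcal{D}<n^2$. The fractal square $F\subset\mathbb{R}^2$ is the unique non-empty compact set with $F=(F+\mathcal{D})/n$. "Component" means connected component; a component is non-trivial if it has more than one point. *)

theory Defs
  imports "HOL-Analysis.Analysis"
begin

definition int_point :: "int \<times> int \<Rightarrow> real^2" where
  "int_point p = vector [of_int (fst p), of_int (snd p)]"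

text \<open>By Hutchinson's theorem, for given \<open>n\<close> and \<open>D\<close> exactly one set \<open>F\<close> satisfies
  this predicate as soon as the conditions on \<open>n\<close> and \<open>D\<close> hold. The sum of two sets is the
  Minkowski sum.\<close>

definition fractal_square :: "nat \<Rightarrow> (int \<times> int) set \<Rightarrow> (real^2) set \<Rightarrow> bool" where
  "fractal_square n D F \<longleftrightarrow>
     n \<ge> 2 \<and> D \<subseteq> {0..int n - 1} \<times> {0..int n - 1} \<and> 1 < card D \<and> card D < n\<^sup>2 \<and>
     F \<noteq> {} \<and> compact F \<and> F = (\<lambda>x. x /\<^sub>R real n) ` (F + int_point ` D)"

definition periodic_extension :: "(real^2) set \<Rightarrow> (real^2) set" where
  "periodic_extension F = F + range int_point"

definition nontrivial_components :: "'a::topological_space set \<Rightarrow> 'a set set" where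
  "nontrivial_components S = {C \<in> components S. \<exists>x\<in>C. \<exists>y\<in>C. x \<noteq> y}"

definition line_segment :: "'a::real_vector set \<Rightarrow> bool" where
  "line_segment S \<longleftrightarrow> (\<exists>a b. a \<noteq> b \<and> S = closed_segment a b)"

definition parallel_line_segments :: "'a::real_vector set set \<Rightarrow> bool" where
  "parallel_line_segments \<C> \<longleftrightarrow>
     (\<exists>v. v \<noteq> 0 \<and> (\<forall>S\<in>\<C>. \<exists>a b. a \<noteq> b \<and> S = closed_segment a b \<and> (\<exists>c. b - a = c *\<^sub>R v)))"

definition totally_disconnected :: "'a::topological_space set \<Rightarrow> bool" where
  "totally_disconnected S \<longleftrightarrow> (\<forall>C\<in>components S. \<exists>x. C = {x})"

end

theory Submission
  imports Defs
begin

text \<open>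
  Write \<open>H = F + \<int>\<^sup>2\<close>; it is closed, invariant under \<open>\<int>\<^sup>2\<close>, and \<open>n H \<subseteq> H\<close>. Everything is decided
  by whether \<open>H\<close> contains two continua \<open>C\<close>, \<open>C'\<close> with non-parallel chords \<open>q - p\<close>, \<open>r - p'\<close>.

  If it does, then \<open>C - C'\<close> has interior: by Brouwer's theorem it covers the plane modulo the
  lattice spanned by the two chords, so Baire's theorem applies. Hence some \<open>n\<^sup>k C\<close> meets an integer
  translate of \<open>n\<^sup>k C'\<close>; gluing and repeating gives one continuum in \<open>H\<close> that has two
  independent integer chords. Its integer translates form a doubly periodic net, which makes all
  components of the complement of \<open>H\<close> bounded.

  If it does not, then every continuum in \<open>H\<close> is a point or a segment of one fixed direction. A
  bounded component of the complement would have a boundary component that separates the plane,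
  which is impossible.

  Finally suppose that all components of \<open>F\<close> are points or segments. Blowing up two non-parallel
  segments gives two non-parallel lines in \<open>H\<close>, and at a suitable intersection point both enter the
  same unit cell, a contradiction (a line along the grid instead puts an edge of the unit square into
  \<open>F\<close>). So the segments are parallel to some \<open>u\<close>. A continuum in \<open>H\<close> can then change its coordinate
  transversal to \<open>u\<close> only on edges of unit cells not parallel to \<open>u\<close>. By self-similarity \<open>F\<close> contains
  such an edge or has empty interior in it, so by Baire the continuum lies on a line parallel to \<open>u\<close>.
\<close>

section \<open>Bounded perturbations of linear maps of the plane\<close>

definition det2 :: "real^2 \<Rightarrow> real^2 \<Rightarrow> real" where
  "det2 a b = a $ 1 * b $ 2 - a $ 2 * b $ 1"

lemma vec2_eq_iff: "(x :: real^2) = y \<longleftrightarrow> x $ 1 = y $ 1 \<and> x $ 2 = y $ 2"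
  by (simp add: vec_eq_iff forall_2)

lemma det2_add_left: "det2 (x + y) b = det2 x b + det2 y b"
  and det2_diff_left: "det2 (x - y) b = det2 x b - det2 y b"
  and det2_add_right: "det2 b (x + y) = det2 b x + det2 b y"
  and det2_diff_right: "det2 b (x - y) = det2 b x - det2 b y"
  and det2_scaleR_left: "det2 (c *\<^sub>R x) b = c * det2 x b"
  and det2_scaleR_right: "det2 b (c *\<^sub>R x) = c * det2 b x"
  by (simp_all add: det2_def algebra_simps)

lemmas det2_simps = det2_add_left det2_diff_left det2_add_right det2_diff_right
  det2_scaleR_left det2_scaleR_right

lemma det2_self [simp]: "det2 a a = 0"
  by (simp add: det2_def)

lemma det2_zero [simp]: "det2 0 a = 0" "det2 a 0 = 0"
  by (simp_all add: det2_def)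

lemma det2_commute: "det2 b a = - det2 a b"
  by (simp add: det2_def)

lemma continuous_on_det2 [continuous_intros]:
  "continuous_on S f \<Longrightarrow> continuous_on S g \<Longrightarrow> continuous_on S (\<lambda>x. det2 (f x) (g x))"
  unfolding det2_def by (intro continuous_intros)

lemma abs_det2_le: "\<bar>det2 a b\<bar> \<le> 2 * norm a * norm b"
proof -
  have "\<bar>a $ 1 * b $ 2\<bar> \<le> norm a * norm b" "\<bar>a $ 2 * b $ 1\<bar> \<le> norm a * norm b"
    by (simp_all add: abs_mult component_le_norm_cart mult_mono)
  then show ?thesis
    unfolding det2_def by linarith
qed

lemma cramer2:
  assumes "det2 a b \<noteq> 0"
  shows "v = (det2 v b / det2 a b) *\<^sub>R a + (det2 a v / det2 a b) *\<^sub>R b"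
proof -
  have "det2 a b *\<^sub>R v = det2 v b *\<^sub>R a + det2 a v *\<^sub>R b"
    by (simp add: vec2_eq_iff det2_def algebra_simps)
  then have "v = (1 / det2 a b) *\<^sub>R (det2 v b *\<^sub>R a + det2 a v *\<^sub>R b)"
    using assms by (simp add: field_simps vec2_eq_iff)
  then show ?thesis
    by (simp add: scaleR_add_right)
qed

lemma parallel_if_det2_eq_0:
  assumes "det2 u v = 0" "u \<noteq> 0"
  obtains c where "v = c *\<^sub>R u"
proof (cases "u $ 1 = 0")
  case True
  then have "v = (v $ 2 / u $ 2) *\<^sub>R u"
    using assms by (auto simp: det2_def vec2_eq_iff)
  then show ?thesis
    by (rule that)
next
  case False
  then have "v = (v $ 1 / u $ 1) *\<^sub>R u"
    using assms by (auto simp: det2_def vec2_eq_iff field_simps)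
  then show ?thesis
    by (rule that)
qed

text \<open>In the basis \<open>a\<close>, \<open>b\<close> the linear part of \<open>\<phi>\<close>
  cancels the summand \<open>p\<close> of \<open>T p\<close>, so that only bounded errors remain and
  Brouwer's theorem applies to \<open>T\<close> on a large ball.\<close>

lemma bounded_perturbation_surj:
  fixes \<phi> :: "real \<times> real \<Rightarrow> real^2"
  assumes ab: "det2 a b \<noteq> 0" and cont: "continuous_on UNIV \<phi>"
    and B: "\<And>s t. norm (\<phi> (s, t) - (s *\<^sub>R a + t *\<^sub>R b)) \<le> B"
  obtains s t where "\<phi> (s, t) = \<tau>"
proof -
  \<comment> \<open>The fixed points of \<open>T\<close> are the solutions of \<open>\<phi> p = \<tau>\<close>, and \<open>T\<close> is bounded.\<close>
  define T where "T p = p + (det2 (\<tau> - \<phi> p) b / det2 a b, det2 a (\<tau> - \<phi> p) / det2 a b)" for p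
  have T_eq: "T (s, t) = (det2 (\<tau> - (\<phi> (s, t) - (s *\<^sub>R a + t *\<^sub>R b))) b / det2 a b,
      det2 a (\<tau> - (\<phi> (s, t) - (s *\<^sub>R a + t *\<^sub>R b))) / det2 a b)" for s t
    using ab by (simp add: T_def det2_simps field_simps)
  define R where "R = (2 * (norm \<tau> + B) * norm b) / \<bar>det2 a b\<bar> + (2 * norm a * (norm \<tau> + B)) / \<bar>det2 a b\<bar>"
  have B0: "B \<ge> 0"
    using B[of 0 0] norm_ge_zero order_trans by blast
  have T_bd: "norm (T p) \<le> R" for p
  proof -
    obtain s t where p: "p = (s, t)" by (cases p)
    define e where "e = \<tau> - (\<phi> (s, t) - (s *\<^sub>R a + t *\<^sub>R b))"
    have e: "norm e \<le> norm \<tau> + B"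
      unfolding e_def using B[of s t] norm_triangle_ineq4 order_trans add_left_mono by blast
    have 1: "\<bar>det2 e b\<bar> \<le> 2 * (norm \<tau> + B) * norm b"
      using abs_det2_le[of e b] mult_right_mono[OF e, of "2 * norm b"] by (simp add: mult_ac)
    have 2: "\<bar>det2 a e\<bar> \<le> 2 * norm a * (norm \<tau> + B)"
      using abs_det2_le[of a e] mult_left_mono[OF e, of "2 * norm a"] by (simp add: mult_ac)
    have "norm (T p) \<le> \<bar>det2 e b / det2 a b\<bar> + \<bar>det2 a e / det2 a b\<bar>"
      unfolding p T_eq e_def[symmetric] using norm_Pair_le by (metis real_norm_def)
    also have "\<dots> \<le> R"
      unfolding R_def abs_divide by (intro add_mono divide_right_mono 1 2) auto
    finally show ?thesis .
  qed
  have "continuous_on (cball 0 R) T"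
    unfolding T_def using ab
    by (intro continuous_intros continuous_on_subset[OF cont]) auto
  moreover have "0 \<le> R"
    unfolding R_def using B0 by simp
  moreover have "T \<in> cball 0 R \<rightarrow> cball 0 R"
    using T_bd by auto
  ultimately obtain p where p: "T p = p"
    by (metis brouwer compact_cball convex_cball cball_eq_empty not_less)
  then have "det2 (\<tau> - \<phi> p) b / det2 a b = 0 \<and> det2 a (\<tau> - \<phi> p) / det2 a b = 0"
    unfolding T_def by (metis add_cancel_right_right prod.inject zero_prod_def)
  then have "\<tau> - \<phi> p = 0"
    using cramer2[OF ab, of "\<tau> - \<phi> p"] by (simp only: scaleR_zero_left add_0)
  then show thesis
    using that[of "fst p" "snd p"] by simp
qed

section \<open>Periodic prolongation of plane paths\<close>

lemma continuous_on_comp_frac: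
  fixes g :: "real \<Rightarrow> 'a::topological_space"
  assumes g: "continuous_on {0..1} g" and eq: "g 0 = g 1"
  shows "continuous_on UNIV (\<lambda>s. g (frac s))"
  unfolding continuous_on_eq_continuous_at[OF open_UNIV]
proof
  fix s :: real
  define k where "k = \<lfloor>s\<rfloor>"
  \<comment> \<open>Only integers are critical: \<open>h\<close> glues the periods to the left and
    to the right of \<open>k\<close>, and these agree at \<open>k\<close> since
    \<open>g 0 = g 1\<close>.\<close>
  define h where "h x = (if x \<le> of_int k then g (x - of_int (k - 1)) else g (x - of_int k))" for x
  have "continuous_on ({of_int k - 1..of_int k} \<union> {of_int k..of_int k + 1}) h"
    unfolding h_def
  proof (rule continuous_on_If)
    show "continuous_on {of_int k - 1..of_int k} (\<lambda>x. g (x - of_int (k - 1)))"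
      by (rule continuous_on_compose2[OF g]) (auto intro!: continuous_intros)
    show "continuous_on {of_int k..of_int k + 1} (\<lambda>x. g (x - of_int k))"
      by (rule continuous_on_compose2[OF g]) (auto intro!: continuous_intros)
  qed (use eq in auto)
  then have "continuous_on {of_int k - 1<..<of_int k + 1} h"
    by (rule continuous_on_subset) auto
  moreover have "h x = g (frac x)" if "x \<in> {of_int k - 1<..<of_int k + 1}" for x
  proof (cases "x < of_int k")
    case True
    then have "\<lfloor>x\<rfloor> = k - 1"
      using that by (simp add: floor_eq_iff)
    then show ?thesis
      using True by (simp add: h_def frac_def)
  next
    case False
    then have "\<lfloor>x\<rfloor> = k"
      using that by (simp add: floor_eq_iff)
    then show ?thesis
      using False eq by (auto simp add: h_def frac_def)
  qed
  ultimately have "continuous_on {of_int k - 1<..<of_int k + 1} (\<lambda>s. g (frac s))"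
    by (simp cong: continuous_on_cong_simp)
  moreover have "s \<in> {of_int k - 1<..<of_int k + 1}"
    using floor_correct[of s] by (simp add: k_def) linarith
  ultimately show "isCont (\<lambda>s. g (frac s)) s"
    by (simp add: continuous_on_eq_continuous_at)
qed

text \<open>The translates of \<open>f\<close> by multiples of its chord \<open>f 1 - f 0\<close>,
  joined end to end. For a path \<open>f\<close> this stays at bounded distance from linear motion
  along the chord.\<close>

definition unroll :: "(real \<Rightarrow> real^2) \<Rightarrow> real \<Rightarrow> real^2" where
  "unroll f s = f (frac s) + of_int \<lfloor>s\<rfloor> *\<^sub>R (f 1 - f 0)"

lemma unroll_linear_part: "unroll f s - s *\<^sub>R (f 1 - f 0) = f (frac s) - frac s *\<^sub>R (f 1 - f 0)"
  by (simp add: unroll_def frac_def algebra_simps)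

lemma continuous_on_unroll:
  assumes "path f"
  shows "continuous_on UNIV (unroll f)"
proof -
  define g where "g s = f s - s *\<^sub>R (f 1 - f 0)" for s
  have "continuous_on {0..1} g"
    unfolding g_def using assms by (auto simp: path_def intro!: continuous_intros)
  then have "continuous_on UNIV (\<lambda>s. g (frac s) + s *\<^sub>R (f 1 - f 0))"
    by (intro continuous_intros continuous_on_comp_frac) (auto simp: g_def)
  moreover have "unroll f = (\<lambda>s. g (frac s) + s *\<^sub>R (f 1 - f 0))"
    unfolding g_def unroll_linear_part[symmetric] by auto
  ultimately show ?thesis
    by simp
qed

lemma unroll_bounded_distance:
  assumes "path f"
  obtains B where "\<And>s. norm (unroll f s - s *\<^sub>R (f 1 - f 0)) \<le> B"
proof -
  have "compact ((\<lambda>s. f s - s *\<^sub>R (f 1 - f 0)) ` {0..1})"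
    using assms by (intro compact_continuous_image) (auto simp: path_def intro!: continuous_intros)
  then obtain B where B: "\<And>s. s \<in> {0..1} \<Longrightarrow> norm (f s - s *\<^sub>R (f 1 - f 0)) \<le> B"
    by (meson compact_imp_bounded bounded_iff imageI)
  have "norm (unroll f s - s *\<^sub>R (f 1 - f 0)) \<le> B" for s
    unfolding unroll_linear_part using B[of "frac s"]
    by (metis atLeastAtMost_iff frac_ge_0 frac_lt_1 less_imp_le)
  then show thesis
    by (rule that)
qed

text \<open>A continuum need not be path connected, but its \<open>\<epsilon>\<close>-neighbourhood
  is open and, as the Minkowski sum of \<open>C\<close> and a ball, connected; hence it is path
  connected.\<close>

lemma path_in_neighbourhood:
  fixes C :: "'a::real_normed_vector set"
  assumes "connected C" "p \<in> C" "q \<in> C" "\<epsilon> > 0"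
  obtains f where "path f" "f 0 = p" "f 1 = q" "\<forall>t\<in>{0..1}. \<exists>x\<in>C. dist x (f t) < \<epsilon>"
proof -
  define V where "V = (\<Union>x\<in>C. ball x \<epsilon>)"
  have "open V"
    unfolding V_def by auto
  moreover have "connected V"
  proof -
    have "V = (\<lambda>(x, y). x + y) ` (C \<times> ball 0 \<epsilon>)"
    proof safe
      fix v assume "v \<in> V"
      then obtain x where "x \<in> C" "dist x v < \<epsilon>"
        by (auto simp: V_def)
      then show "v \<in> (\<lambda>(x, y). x + y) ` (C \<times> ball 0 \<epsilon>)"
        by (intro image_eqI[of _ _ "(x, v - x)"]) (auto simp: dist_norm norm_minus_commute)
    next
      fix x y assume "x \<in> C" "y \<in> ball (0::'a) \<epsilon>"
      then show "x + y \<in> V"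
        by (auto simp: V_def dist_norm intro!: bexI[of _ x])
    qed
    moreover have "connected ((\<lambda>(x, y). x + y) ` (C \<times> ball (0::'a) \<epsilon>))"
      using assms(1) by (intro connected_continuous_image connected_Times)
        (auto simp: case_prod_beta intro!: continuous_intros)
    ultimately show ?thesis by simp
  qed
  ultimately have "path_connected V"
    by (rule connected_open_path_connected)
  moreover have "p \<in> V" "q \<in> V"
    using assms by (auto simp: V_def intro: bexI[of _ p] bexI[of _ q])
  ultimately obtain f where f: "path f" "path_image f \<subseteq> V" "pathstart f = p" "pathfinish f = q"
    unfolding path_connected_def by blast
  have "\<forall>t\<in>{0..1}. f t \<in> V"
    using f(2) by (auto simp: path_image_def)
  then have "\<forall>t\<in>{0..1}. \<exists>x\<in>C. dist x (f t) < \<epsilon>"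
    by (auto simp: V_def)
  then show thesis
    using that f by (auto simp: pathstart_def pathfinish_def)
qed

section \<open>Differences of plane continua\<close>

text \<open>Baire's theorem for the complements: if no member had interior, all complements would be
  open and dense, and their intersection would be dense as well.\<close>

lemma countable_closed_cover_interior:
  fixes \<G> :: "'a::{real_normed_vector,heine_borel} set set"
  assumes "countable \<G>" and cl: "\<And>T. T \<in> \<G> \<Longrightarrow> closed T" and ne: "interior (\<Union>\<G>) \<noteq> {}"
  obtains T where "T \<in> \<G>" "interior T \<noteq> {}"
proof (rule ccontr)
  assume "\<not> thesis"
  with that have empty: "interior T = {}" if "T \<in> \<G>" for T
    using \<open>T \<in> \<G>\<close> by blast
  have "UNIV \<subseteq> closure (\<Inter> (uminus ` \<G>))"
  proof (rule Baire)
    fix T assume "T \<in> uminus ` \<G>"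
    then obtain T' where T': "T' \<in> \<G>" "T = - T'" by auto
    then show "openin (top_of_set UNIV) T \<and> UNIV \<subseteq> closure T"
      using cl[of T'] empty[of T'] by (auto simp: closure_complement)
  qed (use assms in auto)
  also have "\<Inter> (uminus ` \<G>) = - \<Union>\<G>"
    by auto
  finally show False
    using ne by (simp add: closure_complement) blast
qed

text \<open>When \<open>C\<close> and \<open>C'\<close> are joined by paths, the difference of the two unrolled paths is at bounded
  distance from a linear isomorphism, hence surjective.\<close>

lemma continuum_differences_mod_lattice:
  fixes C C' :: "(real^2) set"
  assumes C: "compact C" "connected C" and C': "compact C'" "connected C'"
    and mem: "p \<in> C" "q \<in> C" "p' \<in> C'" "r \<in> C'" and det: "det2 (q - p) (r - p') \<noteq> 0"
  obtains x y and i j :: int where "x \<in> C" "y \<in> C'"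
    "\<tau> = x - y + (of_int i *\<^sub>R (q - p) + of_int j *\<^sub>R (r - p'))"
proof -
  define a b where "a = q - p" and "b = r - p'"
  have ab: "det2 a b \<noteq> 0"
    using det by (simp add: a_def b_def)
  define \<Lambda> where "\<Lambda> = {of_int i *\<^sub>R a + of_int j *\<^sub>R b | i j :: int. True}"
  \<comment> \<open>By Cramer's rule the lattice consists of the vectors with integer coordinates in
    the basis \<open>a\<close>, \<open>b\<close>; this form shows that it is closed.\<close>
  have \<Lambda>_eq: "\<Lambda> = {v. det2 v b / det2 a b \<in> \<int>} \<inter> {v. det2 a v / det2 a b \<in> \<int>}"
  proof (intro equalityI subsetI)
    fix v assume "v \<in> {v. det2 v b / det2 a b \<in> \<int>} \<inter> {v. det2 a v / det2 a b \<in> \<int>}"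
    then obtain i j where "det2 v b / det2 a b = of_int i" "det2 a v / det2 a b = of_int j"
      by (auto elim!: Ints_cases)
    then show "v \<in> \<Lambda>"
      using cramer2[OF ab, of v] unfolding \<Lambda>_def by auto
  qed (use ab in \<open>auto simp: \<Lambda>_def det2_simps\<close>)
  have "closed \<Lambda>"
    unfolding \<Lambda>_eq using ab
    by (intro closed_Int closed_vimage[OF closed_Ints, unfolded vimage_def])
       (auto intro!: continuous_intros)
  define K where "K = {x - y | x y. x \<in> C \<and> y \<in> C'}"
  define S where "S = (\<Union>x\<in>K. \<Union>y\<in>\<Lambda>. {x + y})"
  have "compact K"
    unfolding K_def using C C' by (intro compact_differences)
  \<comment> \<open>As \<open>S\<close> is closed, it is enough to approximate \<open>\<tau>\<close>
    by points of \<open>S\<close>. This permits replacing the continua by nearby paths.\<close>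
  then have "closed S"
    unfolding S_def using \<open>closed \<Lambda>\<close> by (rule compact_closed_sums)
  moreover have "\<exists>d\<in>S. dist d \<tau> < e" if "e > 0" for e
  proof -
    have e2: "e / 2 > 0"
      using that by simp
    obtain f where f: "path f" "f 0 = p" "f 1 = q" "\<forall>t\<in>{0..1}. \<exists>x\<in>C. dist x (f t) < e / 2"
      by (rule path_in_neighbourhood[OF C(2) mem(1,2) e2])
    obtain g where g: "path g" "g 0 = p'" "g 1 = r" "\<forall>t\<in>{0..1}. \<exists>x\<in>C'. dist x (g t) < e / 2"
      by (rule path_in_neighbourhood[OF C'(2) mem(3,4) e2])
    obtain B where B: "\<And>s. norm (unroll f s - s *\<^sub>R a) \<le> B"
      using unroll_bounded_distance[OF f(1)] f by (metis a_def)
    obtain B' where B': "\<And>s. norm (unroll g s - s *\<^sub>R b) \<le> B'"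
      using unroll_bounded_distance[OF g(1)] g by (metis b_def)
    define \<phi> where "\<phi> = (\<lambda>(s, t). unroll f s - unroll g t)"
    have "det2 a (- b) \<noteq> 0"
      using ab by (simp add: det2_def)
    moreover have "continuous_on UNIV \<phi>"
      unfolding \<phi>_def case_prod_beta
      by (intro continuous_intros continuous_on_compose2[OF continuous_on_unroll[OF f(1)]]
          continuous_on_compose2[OF continuous_on_unroll[OF g(1)]]) auto
    moreover have "norm (\<phi> (s, t) - (s *\<^sub>R a + t *\<^sub>R (- b))) \<le> B + B'" for s t
    proof -
      have "\<phi> (s, t) - (s *\<^sub>R a + t *\<^sub>R (- b)) = (unroll f s - s *\<^sub>R a) - (unroll g t - t *\<^sub>R b)"
        by (simp add: \<phi>_def algebra_simps)
      then show ?thesis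
        using order_trans[OF norm_triangle_ineq4 add_mono[OF B B']] by metis
    qed
    ultimately obtain s t where st: "\<phi> (s, t) = \<tau>"
      using bounded_perturbation_surj by blast
    obtain x where x: "x \<in> C" "dist x (f (frac s)) < e / 2"
      using bspec[OF f(4), of "frac s"] by (auto simp: less_imp_le frac_lt_1)
    obtain y where y: "y \<in> C'" "dist y (g (frac t)) < e / 2"
      using bspec[OF g(4), of "frac t"] by (auto simp: less_imp_le frac_lt_1)
    define d where "d = x - y + (of_int \<lfloor>s\<rfloor> *\<^sub>R a + of_int (- \<lfloor>t\<rfloor>) *\<^sub>R b)"
    have "of_int \<lfloor>s\<rfloor> *\<^sub>R a + of_int (- \<lfloor>t\<rfloor>) *\<^sub>R b \<in> \<Lambda>"
      unfolding \<Lambda>_def by blast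
    moreover have "x - y \<in> K"
      using x y by (auto simp: K_def)
    ultimately have "d \<in> S"
      by (auto simp: S_def d_def)
    moreover have "d - \<tau> = (x - f (frac s)) - (y - g (frac t))"
      unfolding d_def st[symmetric] \<phi>_def by (simp add: unroll_def f g a_def b_def algebra_simps)
    then have "dist d \<tau> \<le> dist x (f (frac s)) + dist y (g (frac t))"
      unfolding dist_norm by (metis norm_triangle_ineq4)
    then have "dist d \<tau> < e"
      using x y by simp
    ultimately show ?thesis
      by blast
  qed
  then have "\<tau> \<in> closure S"
    by (auto simp: closure_approachable)
  ultimately have "\<tau> \<in> S"
    by simp
  then show thesis
    using that unfolding S_def K_def \<Lambda>_def a_def b_def by auto
qed

text \<open>Countably many lattice translates of the compact difference set cover the plane, so by
  Baire's theorem one of them has interior.\<close>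

lemma interior_continuum_differences:
  fixes C C' :: "(real^2) set"
  assumes C: "compact C" "connected C" and C': "compact C'" "connected C'"
    and mem: "p \<in> C" "q \<in> C" "p' \<in> C'" "r \<in> C'" and det: "det2 (q - p) (r - p') \<noteq> 0"
  shows "interior {x - y | x y. x \<in> C \<and> y \<in> C'} \<noteq> {}"
proof -
  define K where "K = {x - y | x y. x \<in> C \<and> y \<in> C'}"
  define l where "l = (\<lambda>(i :: int, j :: int). of_int i *\<^sub>R (q - p) + of_int j *\<^sub>R (r - p'))"
  have "compact K"
    unfolding K_def using C C' by (intro compact_differences)
  have "\<tau> \<in> \<Union> (range (\<lambda>z. (+) (l z) ` K))" for \<tau>
  proof -
    obtain x y i j where xy: "x \<in> C" "y \<in> C'" and "\<tau> = x - y + l (i, j)"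
      unfolding l_def prod.case by (rule continuum_differences_mod_lattice[OF assms])
    then have "\<tau> = l (i, j) + (x - y)" "x - y \<in> K"
      by (auto simp: K_def)
    then show ?thesis
      by blast
  qed
  then have "\<Union> (range (\<lambda>z. (+) (l z) ` K)) = UNIV"
    by blast
  then have ne: "interior (\<Union> (range (\<lambda>z. (+) (l z) ` K))) \<noteq> {}"
    by simp
  have cl: "closed T" if "T \<in> range (\<lambda>z. (+) (l z) ` K)" for T
    using that \<open>compact K\<close> by (auto intro: compact_imp_closed compact_translation)
  have "countable (range (\<lambda>z. (+) (l z) ` K))"
    by simp
  then obtain T where T: "T \<in> range (\<lambda>z. (+) (l z) ` K)" "interior T \<noteq> {}"
    using cl ne by (rule countable_closed_cover_interior)
  then show ?thesis
    by (auto simp: interior_translation K_def)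
qed

section \<open>Closed sets invariant under integer translations and dilation\<close>

lemma int_point_component [simp]:
  "int_point p $ 1 = of_int (fst p)" "int_point p $ 2 = of_int (snd p)"
  by (simp_all add: int_point_def)

lemma int_point_add: "int_point (p + q) = int_point p + int_point q"
  and int_point_minus: "int_point (- p) = - int_point p"
  and int_point_diff: "int_point (p - q) = int_point p - int_point q"
  and int_point_zero [simp]: "int_point 0 = 0"
  and int_point_scale: "of_int i *\<^sub>R int_point p = int_point (i * fst p, i * snd p)"
  by (simp_all add: vec2_eq_iff)

text \<open>These properties of the periodic extension relate its continua to the components of its
  complement; the digits enter only for fractal squares.\<close>

locale expanding_periodic_set =
  fixes n :: nat and H :: "(real^2) set"
  assumes n_ge_2: "n \<ge> 2"
    and closed_H: "closed H"
    and periodic: "x \<in> H \<Longrightarrow> x + int_point p \<in> H"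
    and expanding: "x \<in> H \<Longrightarrow> real n *\<^sub>R x \<in> H"
begin

lemma expanding_power: "x \<in> H \<Longrightarrow> (real n ^ k) *\<^sub>R x \<in> H"
proof (induction k)
  case (Suc k)
  then show ?case
    using expanding[of "(real n ^ k) *\<^sub>R x"] by simp
qed simp

lemma n_power_unbounded: obtains k where "real n ^ k > B"
  using real_arch_pow[of "real n" B] n_ge_2 by auto

section \<open>Continua in \<open>H\<close> and their chords\<close>

definition continuum :: "(real^2) set \<Rightarrow> bool" where
  "continuum C \<longleftrightarrow> compact C \<and> connected C \<and> C \<subseteq> H"

text \<open>\<open>C\<close> and \<open>C'\<close> may coincide, so a single continuum that is not
  collinear is enough. This property separates the two alternatives of the theorem.\<close>

definition transversal_continua :: bool where
  "transversal_continua \<longleftrightarrow> (\<exists>C C'. continuum C \<and> continuum C' \<and>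
     (\<exists>p\<in>C. \<exists>q\<in>C. \<exists>p'\<in>C'. \<exists>r\<in>C'. det2 (q - p) (r - p') \<noteq> 0))"

lemma continuum_dilation: "continuum C \<Longrightarrow> continuum ((*\<^sub>R) (real n ^ k) ` C)"
  unfolding continuum_def using expanding_power
  by (auto intro!: compact_scaling connected_continuous_image continuous_intros)

lemma continuum_translation:
  assumes "continuum C"
  shows "continuum ((+) (int_point z) ` C)"
  unfolding continuum_def
proof (intro conjI)
  show "compact ((+) (int_point z) ` C)" "connected ((+) (int_point z) ` C)"
    using assms by (auto simp: continuum_def
        intro!: compact_translation connected_continuous_image continuous_intros)
  show "(+) (int_point z) ` C \<subseteq> H"
    using assms periodic[of _ z] by (auto simp: continuum_def add.commute[of "int_point z"])
qed

text \<open>A disc in \<open>K\<close> is dilated until its radius exceeds 2; it then contains three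
  corners of the unit cell that holds its centre.\<close>

lemma lattice_points_in_dilation:
  assumes "interior K \<noteq> {}"
  obtains k z where "int_point z \<in> (*\<^sub>R) (real n ^ k) ` K"
    "int_point (z + (1, 0)) \<in> (*\<^sub>R) (real n ^ k) ` K"
    "int_point (z + (0, 1)) \<in> (*\<^sub>R) (real n ^ k) ` K"
proof -
  obtain c e where e: "e > 0" "ball c e \<subseteq> K"
    using assms by (metis ex_in_conv mem_interior)
  obtain k where k: "real n ^ k > 2 / e"
    by (rule n_power_unbounded)
  define N where "N = real n ^ k"
  have "N > 0"
    using n_ge_2 by (simp add: N_def)
  have near: "int_point w \<in> (*\<^sub>R) N ` K"
    if "\<bar>of_int (fst w) - N * c $ 1\<bar> \<le> 1" "\<bar>of_int (snd w) - N * c $ 2\<bar> \<le> 1" for w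
  proof -
    have "norm (int_point w - N *\<^sub>R c) \<le> (\<Sum>i\<in>UNIV. \<bar>(int_point w - N *\<^sub>R c) $ i\<bar>)"
      by (rule norm_le_l1_cart)
    also have "\<dots> \<le> 2"
      using that by (simp add: sum_2)
    also have "\<dots> < N * e"
      using k e by (simp add: N_def field_simps)
    finally have *: "norm (int_point w - N *\<^sub>R c) < N * e" .
    have "(1 / N) *\<^sub>R int_point w - c = (1 / N) *\<^sub>R (int_point w - N *\<^sub>R c)"
      using \<open>N > 0\<close> by (simp add: scaleR_diff_right)
    then have "dist c ((1 / N) *\<^sub>R int_point w) = norm (int_point w - N *\<^sub>R c) / N"
      using \<open>N > 0\<close> by (simp add: dist_norm norm_minus_commute[of c])
    also have "\<dots> < e"
      using * \<open>N > 0\<close> by (simp add: field_simps)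
    finally have "(1 / N) *\<^sub>R int_point w \<in> K"
      using e by auto
    then show ?thesis
      using \<open>N > 0\<close> by (intro image_eqI[of _ _ "(1 / N) *\<^sub>R int_point w"]) auto
  qed
  define z where "z = (\<lfloor>N * c $ 1\<rfloor>, \<lfloor>N * c $ 2\<rfloor>)"
  show thesis
    by (rule that[of z k]; unfold N_def[symmetric]; rule near;
        use floor_correct[of "N * c $ 1"] floor_correct[of "N * c $ 2"] in
        \<open>simp add: z_def; linarith\<close>)
qed

text \<open>Twice a difference set with interior is dilated until it contains lattice points. The
  first time, this glues dilates of \<open>C\<close> and \<open>C'\<close> into one continuum
  \<open>E\<close>; the second time, the lattice points are chords of a dilate of
  \<open>E\<close>.\<close>

lemma lattice_chords:
  assumes transversal_continua
  obtains \<Gamma> m m' v w where "continuum \<Gamma>" "m \<in> \<Gamma>" "m + int_point v \<in> \<Gamma>"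
    "m' \<in> \<Gamma>" "m' + int_point w \<in> \<Gamma>" "det2 (int_point v) (int_point w) \<noteq> 0"
proof -
  obtain C C' p q p' r where C: "continuum C" and C': "continuum C'"
    and mem: "p \<in> C" "q \<in> C" "p' \<in> C'" "r \<in> C'" and det: "det2 (q - p) (r - p') \<noteq> 0"
    using assms unfolding transversal_continua_def by auto
  have "interior {x - y | x y. x \<in> C \<and> y \<in> C'} \<noteq> {}"
    using interior_continuum_differences[OF _ _ _ _ mem det] C C' by (simp add: continuum_def)
  then obtain k z where "int_point z \<in> (*\<^sub>R) (real n ^ k) ` {x - y | x y. x \<in> C \<and> y \<in> C'}"
    by (rule lattice_points_in_dilation)
  then obtain x y where xy: "x \<in> C" "y \<in> C'" and z: "int_point z = (real n ^ k) *\<^sub>R (x - y)"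
    by auto
  define N where "N = real n ^ k"
  define E where "E = (*\<^sub>R) N ` C \<union> (+) (int_point z) ` (*\<^sub>R) N ` C'"
  have "N *\<^sub>R x = int_point z + N *\<^sub>R y"
    by (simp add: z N_def scaleR_diff_right)
  then have "(*\<^sub>R) N ` C \<inter> (+) (int_point z) ` (*\<^sub>R) N ` C' \<noteq> {}"
    using xy by blast
  moreover have "continuum ((*\<^sub>R) N ` C)" "continuum ((+) (int_point z) ` (*\<^sub>R) N ` C')"
    unfolding N_def using C C' by (blast intro: continuum_translation continuum_dilation)+
  ultimately have E: "continuum E"
    unfolding E_def continuum_def by (meson Un_least compact_Un connected_Un)
  have "det2 (N *\<^sub>R q - N *\<^sub>R p) ((int_point z + N *\<^sub>R r) - (int_point z + N *\<^sub>R p')) \<noteq> 0"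
    using det n_ge_2 unfolding add_diff_cancel_left scaleR_diff_right[symmetric]
    by (simp add: N_def det2_scaleR_left det2_scaleR_right)
  moreover have "N *\<^sub>R p \<in> E" "N *\<^sub>R q \<in> E" "int_point z + N *\<^sub>R p' \<in> E" "int_point z + N *\<^sub>R r \<in> E"
    using mem by (auto simp: E_def)
  ultimately have "interior {x - y | x y. x \<in> E \<and> y \<in> E} \<noteq> {}"
    using E interior_continuum_differences unfolding continuum_def by meson
  then obtain k' v where v:
    "int_point v \<in> (*\<^sub>R) (real n ^ k') ` {x - y | x y. x \<in> E \<and> y \<in> E}"
    "int_point (v + (1, 0)) \<in> (*\<^sub>R) (real n ^ k') ` {x - y | x y. x \<in> E \<and> y \<in> E}"
    "int_point (v + (0, 1)) \<in> (*\<^sub>R) (real n ^ k') ` {x - y | x y. x \<in> E \<and> y \<in> E}"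
    by (rule lattice_points_in_dilation)
  define \<Gamma> where "\<Gamma> = (*\<^sub>R) (real n ^ k') ` E"
  have \<Gamma>: "continuum \<Gamma>"
    unfolding \<Gamma>_def using E by (rule continuum_dilation)
  have chord: "\<exists>m. m \<in> \<Gamma> \<and> m + int_point w \<in> \<Gamma>"
    if w: "int_point w \<in> (*\<^sub>R) (real n ^ k') ` {x - y | x y. x \<in> E \<and> y \<in> E}" for w
  proof -
    obtain x y where "x \<in> E" "y \<in> E" "int_point w = (real n ^ k') *\<^sub>R (x - y)"
      using w by auto
    then show ?thesis
      by (intro exI[of _ "(real n ^ k') *\<^sub>R y"]) (auto simp: \<Gamma>_def scaleR_diff_right)
  qed
  obtain m0 where m0: "m0 \<in> \<Gamma>" "m0 + int_point v \<in> \<Gamma>"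
    using chord[OF v(1)] by blast
  obtain m1 where m1: "m1 \<in> \<Gamma>" "m1 + int_point (v + (1, 0)) \<in> \<Gamma>"
    using chord[OF v(2)] by blast
  obtain m2 where m2: "m2 \<in> \<Gamma>" "m2 + int_point (v + (0, 1)) \<in> \<Gamma>"
    using chord[OF v(3)] by blast
  \<comment> \<open>For \<open>v = (x, y)\<close> the first two determinants are \<open>- y\<close>
    and \<open>x\<close>; if \<open>v = 0\<close>, the third one is 1.\<close>
  consider "det2 (int_point v) (int_point (v + (1, 0))) \<noteq> 0"
    | "det2 (int_point v) (int_point (v + (0, 1))) \<noteq> 0"
    | "det2 (int_point (v + (1, 0))) (int_point (v + (0, 1))) \<noteq> 0"
    by (cases "fst v = 0 \<and> snd v = 0") (auto simp: det2_def algebra_simps)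
  then show thesis
    by cases (rule that[OF \<Gamma> m0 m1] that[OF \<Gamma> m0 m2] that[OF \<Gamma> m1 m2]; assumption)+
qed

text \<open>The translates of \<open>\<Gamma>\<close> by multiples of \<open>v\<close> form a connected barrier along the direction \<open>v\<close>, and \<open>U\<close>
  cannot cross its translates by multiples of \<open>w\<close>. The crossing path \<open>\<sigma>\<close> is prolonged by straight rays
  so that its difference with the unrolled barrier is surjective.\<close>

lemma chord_barrier:
  assumes \<Gamma>: "continuum \<Gamma>" and m: "m \<in> \<Gamma>" "m + int_point v \<in> \<Gamma>"
    and det: "det2 (int_point v) (int_point w) \<noteq> 0" and U: "U \<in> components (- H)"
  obtains B where "\<And>x y. x \<in> U \<Longrightarrow> y \<in> U \<Longrightarrow>
    \<bar>det2 (int_point v) (y - x) / det2 (int_point v) (int_point w)\<bar> \<le> B"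
proof -
  define a b where "a = int_point v" and "b = int_point w"
  \<comment> \<open>The coordinate along \<open>b\<close> in the basis \<open>a\<close>,
    \<open>b\<close>. It does not change in direction \<open>a\<close>, so a bound near
    \<open>\<Gamma>\<close> holds along the whole barrier.\<close>
  define \<beta> where "\<beta> x = det2 a x / det2 a b" for x
  have ab: "det2 a b \<noteq> 0"
    using det by (simp add: a_def b_def)
  have \<beta>_add: "\<beta> (x + y) = \<beta> x + \<beta> y" and \<beta>_diff: "\<beta> (x - y) = \<beta> x - \<beta> y"
    and \<beta>_scale: "\<beta> (c *\<^sub>R x) = c * \<beta> x" and \<beta>_a: "\<beta> a = 0" and \<beta>_b: "\<beta> b = 1" for x y c
    using ab by (simp_all add: \<beta>_def det2_simps add_divide_distrib diff_divide_distrib)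
  have "bounded {x + y | x y. x \<in> \<Gamma> \<and> y \<in> cball 0 1}"
    using \<Gamma> by (intro compact_imp_bounded compact_sums) (auto simp: continuum_def)
  then obtain R where R: "\<And>x. x \<in> {x + y | x y. x \<in> \<Gamma> \<and> y \<in> cball 0 1} \<Longrightarrow> norm x \<le> R"
    unfolding bounded_iff by blast
  define B where "B = 2 * norm a * R / \<bar>det2 a b\<bar>"
  have \<beta>_near: "\<bar>\<beta> x\<bar> \<le> B" if "y \<in> \<Gamma>" "dist y x < 1" for x y
  proof -
    have "x = y + (x - y)" "x - y \<in> cball 0 1"
      using that by (auto simp: dist_norm norm_minus_commute)
    then have "norm x \<le> R"
      using R that(1) by blast
    then have "\<bar>det2 a x\<bar> \<le> 2 * norm a * R"
      using abs_det2_le[of a x] mult_left_mono[of "norm x" R "2 * norm a"] by simp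
    then show ?thesis
      by (simp add: \<beta>_def B_def divide_right_mono)
  qed
  have conn: "path_connected U"
    using U closed_H by (metis connected_open_path_connected in_components_connected open_Compl open_components)
  have "\<beta> y - \<beta> x \<le> 2 * B + 1" if xy: "x \<in> U" "y \<in> U" for x y
  proof (rule ccontr)
    assume gap: "\<not> \<beta> y - \<beta> x \<le> 2 * B + 1"
    obtain \<sigma> where \<sigma>: "path \<sigma>" "path_image \<sigma> \<subseteq> U" "\<sigma> 0 = x" "\<sigma> 1 = y"
      using conn xy unfolding path_connected_def pathstart_def pathfinish_def by blast
    have "path_image \<sigma> \<inter> H = {}"
      using \<sigma>(2) in_components_subset[OF U] by auto
    then obtain \<delta> where \<delta>: "\<delta> > 0" "\<And>x y. x \<in> path_image \<sigma> \<Longrightarrow> y \<in> H \<Longrightarrow> \<delta> \<le> dist x y"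
      using separate_compact_closed[OF compact_path_image[OF \<sigma>(1)] closed_H] by auto
    obtain f where f: "path f" "f 0 = m" "f 1 = m + a"
      "\<forall>t\<in>{0..1}. \<exists>x\<in>\<Gamma>. dist x (f t) < min \<delta> 1"
    proof (rule path_in_neighbourhood)
      show "connected \<Gamma>" "m \<in> \<Gamma>" "m + a \<in> \<Gamma>" "min \<delta> 1 > 0"
        using \<Gamma> m \<delta>(1) by (auto simp: continuum_def a_def)
    qed
    have f_disp: "f 1 - f 0 = a"
      using f by simp
    \<comment> \<open>The largest integer that moves \<open>x\<close> strictly below the band where
      \<open>\<beta>\<close> has absolute value at most \<open>B\<close>; the gap of more than
      \<open>2 * B + 1\<close> then puts \<open>y\<close> above the band.\<close>
    define j where "j = \<lceil>- B - \<beta> x\<rceil> - 1"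
    have j: "\<beta> x + of_int j < - B" "\<beta> y + of_int j > B"
      using gap unfolding j_def by linarith+
    define cl where "cl t = max 0 (min 1 t)" for t :: real
    have cl01: "cl t \<in> {0..1}" for t
      by (auto simp: cl_def)
    define g where "g t = \<sigma> (cl t) + of_int j *\<^sub>R b + (t - cl t) *\<^sub>R b" for t
    have cont_cl: "continuous_on UNIV cl"
      unfolding cl_def by (intro continuous_intros)
    have "continuous_on UNIV (\<lambda>t. \<sigma> (cl t))"
      using \<sigma>(1) cl01 unfolding path_def
      by (intro continuous_on_compose2[OF _ cont_cl, of "{0..1}"]) auto
    then have cont_g: "continuous_on UNIV g"
      unfolding g_def by (intro continuous_intros cont_cl)
    obtain B1 where B1: "\<And>s. norm (unroll f s - s *\<^sub>R a) \<le> B1"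
      using unroll_bounded_distance[OF f(1)] unfolding f_disp by metis
    obtain B2 where B2: "\<And>t. t \<in> {0..1} \<Longrightarrow> norm (\<sigma> t + of_int j *\<^sub>R b - t *\<^sub>R b) \<le> B2"
    proof -
      have "compact ((\<lambda>t. \<sigma> t + of_int j *\<^sub>R b - t *\<^sub>R b) ` {0..1})"
        using \<sigma>(1) by (intro compact_continuous_image) (auto simp: path_def intro!: continuous_intros)
      then show thesis
        using that by (meson compact_imp_bounded bounded_iff imageI)
    qed
    define \<phi> where "\<phi> = (\<lambda>(s, t). unroll f s - g t)"
    have "det2 a (- b) \<noteq> 0"
      using ab by (simp add: det2_def)
    moreover have "continuous_on UNIV \<phi>"
      unfolding \<phi>_def case_prod_beta
      by (intro continuous_intros continuous_on_compose2[OF continuous_on_unroll[OF f(1)]]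
          continuous_on_compose2[OF cont_g]) auto
    moreover have "norm (\<phi> (s, t) - (s *\<^sub>R a + t *\<^sub>R (- b))) \<le> B1 + B2" for s t
    proof -
      have "\<phi> (s, t) - (s *\<^sub>R a + t *\<^sub>R (- b)) =
          (unroll f s - s *\<^sub>R a) - (\<sigma> (cl t) + of_int j *\<^sub>R b - cl t *\<^sub>R b)"
        by (simp add: \<phi>_def g_def algebra_simps)
      then show ?thesis
        using order_trans[OF norm_triangle_ineq4 add_mono[OF B1 B2[OF cl01]]] by metis
    qed
    ultimately obtain s t where "\<phi> (s, t) = 0"
      using bounded_perturbation_surj by blast
    then have st: "f (frac s) + of_int \<lfloor>s\<rfloor> *\<^sub>R a = g t"
      by (simp add: \<phi>_def unroll_def f_disp)
    obtain h where h: "h \<in> \<Gamma>" "dist h (f (frac s)) < min \<delta> 1"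
      using bspec[OF f(4), of "frac s"] by (auto simp: less_imp_le frac_lt_1)
    have "\<bar>\<beta> (f (frac s))\<bar> \<le> B"
      using \<beta>_near h by simp
    moreover have "\<beta> (g t) = \<beta> (f (frac s))"
      unfolding st[symmetric] by (simp add: \<beta>_add \<beta>_scale \<beta>_a)
    moreover have "\<beta> (g t) = \<beta> (\<sigma> (cl t)) + of_int j + (t - cl t)"
      by (simp add: g_def \<beta>_add \<beta>_scale \<beta>_b)
    ultimately have bd: "\<bar>\<beta> (\<sigma> (cl t)) + of_int j + (t - cl t)\<bar> \<le> B"
      by simp
    have "t \<in> {0..1}"
    proof (rule ccontr)
      assume "t \<notin> {0..1}"
      then consider "t < 0" | "t > 1" by force
      then show False
        by cases (use bd j \<sigma> in \<open>auto simp: cl_def\<close>)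
    qed
    then have "cl t = t"
      by (auto simp: cl_def)
    then have "\<sigma> t = f (frac s) + (of_int \<lfloor>s\<rfloor> *\<^sub>R a + of_int (- j) *\<^sub>R b)"
      using st by (simp add: g_def algebra_simps)
    moreover have "of_int \<lfloor>s\<rfloor> *\<^sub>R a + of_int (- j) *\<^sub>R b =
        int_point ((\<lfloor>s\<rfloor> * fst v, \<lfloor>s\<rfloor> * snd v) + (- j * fst w, - j * snd w))"
      unfolding a_def b_def int_point_add int_point_scale by simp
    ultimately obtain u where u: "\<sigma> t = f (frac s) + int_point u"
      by metis
    have "h + int_point u \<in> H"
      using h \<Gamma> periodic unfolding continuum_def by blast
    moreover have "\<sigma> t \<in> path_image \<sigma>"
      using \<open>t \<in> {0..1}\<close> by (simp add: path_image_def)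
    ultimately have "\<delta> \<le> dist (\<sigma> t) (h + int_point u)"
      using \<delta>(2) by blast
    also have "\<dots> = dist h (f (frac s))"
      by (simp add: u dist_norm norm_minus_commute)
    finally show False
      using h by simp
  qed
  note bound = this
  have "\<bar>\<beta> (y - x)\<bar> \<le> 2 * B + 1" if "x \<in> U" "y \<in> U" for x y
    using bound[OF that] bound[OF that(2,1)] by (simp add: \<beta>_diff abs_le_iff)
  then show thesis
    using that unfolding \<beta>_def a_def b_def by blast
qed

text \<open>The barriers along the two lattice chords bound both coordinates of differences of
  points of \<open>U\<close>; the second bound arises by exchanging \<open>v\<close> and
  \<open>w\<close>.\<close>

lemma bounded_components_if_transversal:
  assumes transversal_continua and U: "U \<in> components (- H)"
  shows "bounded U"
proof -
  obtain \<Gamma> m m' v w where \<Gamma>: "continuum \<Gamma>" "m \<in> \<Gamma>" "m + int_point v \<in> \<Gamma>"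
    "m' \<in> \<Gamma>" "m' + int_point w \<in> \<Gamma>" and det: "det2 (int_point v) (int_point w) \<noteq> 0"
    by (rule lattice_chords[OF assms(1)])
  define a b where "a = int_point v" and "b = int_point w"
  have ab: "det2 a b \<noteq> 0" "det2 b a \<noteq> 0"
    using det by (simp_all add: a_def b_def det2_commute[of "int_point w"])
  obtain B where B: "\<And>x y. x \<in> U \<Longrightarrow> y \<in> U \<Longrightarrow> \<bar>det2 a (y - x) / det2 a b\<bar> \<le> B"
    using chord_barrier[OF \<Gamma>(1-3) det U] unfolding a_def b_def by blast
  obtain B' where B': "\<And>x y. x \<in> U \<Longrightarrow> y \<in> U \<Longrightarrow> \<bar>det2 b (y - x) / det2 b a\<bar> \<le> B'"
    using chord_barrier[OF \<Gamma>(1,4,5) ab(2)[unfolded a_def b_def] U] unfolding a_def b_def by blast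
  obtain x where x: "x \<in> U"
    using in_components_nonempty[OF U] by blast
  have "dist x y \<le> B' * norm a + B * norm b" if y: "y \<in> U" for y
  proof -
    have "norm (y - x) \<le> \<bar>det2 b (y - x) / det2 b a\<bar> * norm a + \<bar>det2 a (y - x) / det2 a b\<bar> * norm b"
      by (subst cramer2[OF ab(1), of "y - x"], rule order_trans[OF norm_triangle_ineq])
         (simp add: det2_commute[of b])
    also have "\<dots> \<le> B' * norm a + B * norm b"
      using B[OF x y] B'[OF x y] by (intro add_mono mult_right_mono) auto
    finally show ?thesis
      by (simp add: dist_norm norm_minus_commute)
  qed
  then show ?thesis
    unfolding bounded_def by blast
qed

section \<open>The complement in the absence of transversal continua\<close>

lemma collinear_continuum:
  assumes "\<not> transversal_continua" "continuum C"
  shows "collinear C"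
proof (cases "\<exists>p\<in>C. \<exists>q\<in>C. q \<noteq> p")
  case True
  then obtain p q where pq: "p \<in> C" "q \<in> C" "q - p \<noteq> 0"
    by auto
  have "\<exists>c. x - y = c *\<^sub>R (q - p)" if "x \<in> C" "y \<in> C" for x y
    using assms pq that parallel_if_det2_eq_0[of "q - p" "x - y"]
    unfolding transversal_continua_def by meson
  then show ?thesis
    unfolding collinear_def by blast
next
  case False
  then have "\<forall>x\<in>C. \<forall>y\<in>C. x - y = 0 *\<^sub>R 0"
    by auto
  then show ?thesis
    unfolding collinear_def by blast
qed

text \<open>The boundary of a bounded \<open>U\<close> separates the plane, hence one of its
  components does. That component is a continuum in \<open>H\<close>, so it is collinear and thus
  convex, but a compact convex set does not separate the plane.\<close>

lemma unbounded_components_if_not_transversal: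
  assumes nt: "\<not> transversal_continua" and U: "U \<in> components (- H)"
  shows "\<not> bounded U"
proof
  assume bd: "bounded U"
  have "open U" "U \<noteq> {}"
    using U closed_H in_components_nonempty[OF U] by (auto intro: open_components)
  have "\<not> connected (- frontier U)"
  proof
    assume conn: "connected (- frontier U)"
    have "U \<inter> frontier U = {}"
      using \<open>open U\<close> by (auto simp: frontier_def interior_open)
    then have "- frontier U \<inter> U \<noteq> {}"
      using \<open>U \<noteq> {}\<close> by blast
    moreover have "- frontier U - U \<noteq> {}"
    proof
      assume "- frontier U - U = {}"
      then have "closure U = UNIV"
        by (auto simp: closure_Un_frontier)
      then show False
        using bounded_closure[OF bd] not_bounded_UNIV by metis
    qed
    ultimately show False
      using connected_Int_frontier[OF conn, of U] by blast
  qed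
  then obtain C where C: "C \<in> components (frontier U)" "\<not> connected (- C)"
    using separation_by_component_closed[OF frontier_closed] by blast
  have "compact C"
    using C(1) bd by (auto intro: compact_components compact_frontier_bounded)
  have "continuum C"
    using C(1) closed_H U \<open>compact C\<close> in_components_subset[OF C(1)]
      frontier_of_components_closed_complement[OF closed_H U]
    by (auto simp: continuum_def intro: in_components_connected)
  then have "convex C"
    using collinear_continuum[OF nt] convex_connected_collinear by (auto simp: continuum_def)
  then have "connected (- C)"
    using \<open>compact C\<close> by (intro connected_complement_bounded_convex) (auto simp: compact_imp_bounded)
  then show False
    using C(2) by simp
qed

end

section \<open>Fractal squares\<close>

lemma int_point_Ints [simp]: "int_point p $ i \<in> \<int>"
  using exhaust_2[of i] by auto

lemma int_point_of_coords: "int_point (f 1, f 2) $ i = of_int (f i)"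
  using exhaust_2[of i] by auto

lemma range_int_point: "range int_point = {v. \<forall>i. v $ i \<in> \<int>}"
proof (intro equalityI subsetI)
  fix v :: "real^2" assume "v \<in> {v. \<forall>i. v $ i \<in> \<int>}"
  then obtain a b where "v $ 1 = of_int a" "v $ 2 = of_int b"
    by (metis Ints_cases mem_Collect_eq)
  then have "v = int_point (a, b)"
    by (simp add: vec2_eq_iff)
  then show "v \<in> range int_point" by blast
qed auto

lemma int_less_1_eq_0:
  assumes "x \<in> \<int>" "\<bar>x\<bar> < (1::real)"
  shows "x = 0"
  using assms Ints_nonzero_abs_less1 by blast

locale fractal_square_set =
  fixes n :: nat and D :: "(int \<times> int) set" and F :: "(real^2) set"
  assumes fs: "fractal_square n D F"
begin

abbreviation H :: "(real^2) set" where
  "H \<equiv> periodic_extension F"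

lemma n_ge: "n \<ge> 2" and D_subset: "D \<subseteq> {0..int n - 1} \<times> {0..int n - 1}"
  and card_D: "card D < n\<^sup>2" and F_ne: "F \<noteq> {}" and compact_F: "compact F"
  using fs by (auto simp: fractal_square_def)

lemma F_self_similar:
  assumes "x \<in> F"
  obtains f d where "f \<in> F" "d \<in> D" "real n *\<^sub>R x = f + int_point d"
proof -
  have "x \<in> (\<lambda>x. x /\<^sub>R real n) ` (F + int_point ` D)"
    using fs assms unfolding fractal_square_def by metis
  then obtain f d where "f \<in> F" "d \<in> D" "x = (f + int_point d) /\<^sub>R real n"
    by (auto elim!: set_plus_elim)
  then show thesis
    using that n_ge by simp
qed

lemma digit_bounds:
  assumes "d \<in> D"
  shows "0 \<le> int_point d $ i" "int_point d $ i \<le> real n - 1"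
proof -
  have "0 \<le> fst d" "0 \<le> snd d" "fst d \<le> int n - 1" "snd d \<le> int n - 1"
    using assms D_subset by auto
  then have "0 \<le> real_of_int (fst d)" "0 \<le> real_of_int (snd d)"
    "real_of_int (fst d) \<le> real n - 1" "real_of_int (snd d) \<le> real n - 1"
    by linarith+
  then show "0 \<le> int_point d $ i" "int_point d $ i \<le> real n - 1"
    using exhaust_2[of i] by auto
qed

text \<open>At a point \<open>b\<close> of \<open>F\<close> where coordinate \<open>i\<close> is
  maximal, self-similarity gives \<open>real n * b $ i \<le> b $ i + (real n - 1)\<close>; the
  minimum is treated similarly.\<close>

lemma unit_square:
  assumes "x \<in> F"
  shows "0 \<le> x $ i" "x $ i \<le> 1"
proof -
  have cont: "continuous_on F (\<lambda>x. x $ i)"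
    by (intro continuous_intros)
  obtain b where b: "b \<in> F" "\<And>y. y \<in> F \<Longrightarrow> y $ i \<le> b $ i"
    using continuous_attains_sup[OF compact_F F_ne cont] by blast
  obtain f d where fd: "f \<in> F" "d \<in> D" "real n *\<^sub>R b = f + int_point d"
    using F_self_similar[OF b(1)] .
  have "real n * b $ i = f $ i + int_point d $ i"
    using arg_cong[OF fd(3), of "\<lambda>v. v $ i"] by simp
  then have "real n * b $ i \<le> b $ i + (real n - 1)"
    using b(2)[OF fd(1)] digit_bounds(2)[OF fd(2), of i] by linarith
  then have "(real n - 1) * b $ i \<le> (real n - 1) * 1"
    by (simp add: algebra_simps)
  then have "b $ i \<le> 1"
    using n_ge by (subst (asm) mult_le_cancel_left_pos) auto
  then show "x $ i \<le> 1"
    using b(2)[OF assms] by simp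
  obtain a where a: "a \<in> F" "\<And>y. y \<in> F \<Longrightarrow> a $ i \<le> y $ i"
    using continuous_attains_inf[OF compact_F F_ne cont] by blast
  obtain f d where fd: "f \<in> F" "d \<in> D" "real n *\<^sub>R a = f + int_point d"
    using F_self_similar[OF a(1)] .
  have "real n * a $ i = f $ i + int_point d $ i"
    using arg_cong[OF fd(3), of "\<lambda>v. v $ i"] by simp
  then have "a $ i \<le> real n * a $ i"
    using a(2)[OF fd(1)] digit_bounds(1)[OF fd(2), of i] by linarith
  then have "(real n - 1) * 0 \<le> (real n - 1) * a $ i"
    by (simp add: algebra_simps)
  then have "0 \<le> a $ i"
    using n_ge by (subst (asm) mult_le_cancel_left_pos) auto
  then show "0 \<le> x $ i"
    using a(2)[OF assms] by simp
qed

lemma in_H_iff: "x \<in> H \<longleftrightarrow> (\<exists>z. x - int_point z \<in> F)"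
proof
  assume "x \<in> H"
  then obtain f z where "f \<in> F" "x = f + int_point z"
    by (auto simp: periodic_extension_def elim!: set_plus_elim)
  then show "\<exists>z. x - int_point z \<in> F"
    by (intro exI[of _ z]) simp
next
  assume "\<exists>z. x - int_point z \<in> F"
  then obtain z where "x - int_point z \<in> F" by blast
  then have "(x - int_point z) + int_point z \<in> F + range int_point"
    by (intro set_plus_intro) auto
  then show "x \<in> H"
    by (simp add: periodic_extension_def)
qed

lemma F_subset_H: "F \<subseteq> H"
proof
  fix x assume "x \<in> F"
  then show "x \<in> H"
    unfolding in_H_iff by (intro exI[of _ 0]) simp
qed

sublocale expanding_periodic_set n H
proof
  show "n \<ge> 2" by (rule n_ge)
  have "closed {v :: real^2. \<forall>i. v $ i \<in> \<int>}"
    by (intro closed_Collect_all closed_vimage[OF closed_Ints, unfolded vimage_def])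
       (auto intro!: continuous_intros)
  then have "closed (\<Union>x\<in>F. \<Union>y\<in>range int_point. {x + y})"
    unfolding range_int_point[symmetric] by (rule compact_closed_sums[OF compact_F])
  also have "(\<Union>x\<in>F. \<Union>y\<in>range int_point. {x + y}) = H"
    by (auto simp: periodic_extension_def set_plus_def)
  finally show "closed H" .
  show "x + int_point p \<in> H" if x: "x \<in> H" for x p
  proof -
    obtain z where "x - int_point z \<in> F"
      using x unfolding in_H_iff ..
    then show ?thesis
      unfolding in_H_iff by (intro exI[of _ "p + z"]) (simp only: int_point_add, simp)
  qed
  show "real n *\<^sub>R x \<in> H" if x: "x \<in> H" for x
  proof -
    obtain z where z: "x - int_point z \<in> F"
      using x unfolding in_H_iff ..
    obtain f d where fd: "f \<in> F" "d \<in> D" "real n *\<^sub>R (x - int_point z) = f + int_point d"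
      using F_self_similar[OF z] .
    have "real n *\<^sub>R int_point z = int_point (int n * fst z, int n * snd z)"
      using int_point_scale[of "int n" z] by simp
    then have "real n *\<^sub>R x - int_point (d + (int n * fst z, int n * snd z)) = f"
      using fd(3) unfolding int_point_add by (simp add: scaleR_diff_right algebra_simps)
    then show ?thesis
      unfolding in_H_iff using fd(1) by blast
  qed
qed

text \<open>A point in the interior of a unit cell lies in no other integer translate of the unit
  square.\<close>

lemma H_in_open_cell:
  assumes "x \<in> H" and cell: "\<And>i. 0 < (x - int_point z) $ i" "\<And>i. (x - int_point z) $ i < 1"
  shows "x - int_point z \<in> F"
proof -
  obtain w where w: "x - int_point w \<in> F"
    using assms(1) unfolding in_H_iff ..
  have "int_point (w - z) $ i = 0" for i
  proof (rule int_less_1_eq_0)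
    show "\<bar>int_point (w - z) $ i\<bar> < 1"
      using cell[of i] unit_square[OF w, of i] by (simp add: int_point_diff)
  qed simp
  then have "int_point w = int_point z"
    unfolding int_point_diff by (simp add: vec_eq_iff)
  then show ?thesis
    using w by simp
qed

text \<open>The centre of the small square of a missing digit is not in \<open>H\<close>. This
  ensures that the complement has a component at all.\<close>

lemma H_ne_UNIV: "- H \<noteq> {}"
proof -
  have "finite ({0..int n - 1} \<times> {0..int n - 1})"
    by simp
  moreover have "card ({0..int n - 1} \<times> {0..int n - 1}) = n\<^sup>2"
    by (simp add: card_cartesian_product power2_eq_square)
  ultimately obtain d where d: "d \<in> {0..int n - 1} \<times> {0..int n - 1}" "d \<notin> D"
    using card_D D_subset by (metis less_irrefl subsetI subset_antisym)
  define h :: "real^2" where "h = (\<chi> i. 1 / 2)"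
  define x where "x = (1 / real n) *\<^sub>R (int_point d + h)"
  have nx: "real n *\<^sub>R x = int_point d + h"
    using n_ge by (simp add: x_def)
  have "0 \<le> fst d" "0 \<le> snd d" "fst d \<le> int n - 1" "snd d \<le> int n - 1"
    using d(1) by auto
  then have "0 \<le> real_of_int (fst d)" "0 \<le> real_of_int (snd d)"
    "real_of_int (fst d) \<le> real n - 1" "real_of_int (snd d) \<le> real n - 1"
    by linarith+
  then have "0 \<le> int_point d $ i \<and> int_point d $ i \<le> real n - 1" for i
    using exhaust_2[of i] by auto
  then have bd: "0 \<le> int_point d $ i" "int_point d $ i \<le> real n - 1" for i
    by blast+
  have "0 < x $ i \<and> x $ i < 1" for i
    using n_ge bd[of i] by (simp add: x_def h_def field_simps)
  moreover have "x \<notin> F"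
  proof
    assume "x \<in> F"
    then obtain f e where fe: "f \<in> F" "e \<in> D" "real n *\<^sub>R x = f + int_point e"
      by (rule F_self_similar)
    have eq0: "int_point (e - d) $ i = 0" for i
    proof (rule int_less_1_eq_0)
      have "int_point d $ i + 1 / 2 = f $ i + int_point e $ i"
        using arg_cong[OF fe(3)[unfolded nx], of "\<lambda>v. v $ i"] by (simp add: h_def)
      then show "\<bar>int_point (e - d) $ i\<bar> < 1"
        using unit_square[OF fe(1), of i] by (simp add: int_point_diff)
    qed simp
    have "e = d"
      using eq0[of 1] eq0[of 2] by (simp add: prod_eq_iff)
    then show False
      using fe d by simp
  qed
  ultimately have "x \<notin> H"
    using H_in_open_cell[of x 0] by auto
  then show ?thesis by blast
qed

section \<open>Sides of the unit square and their traces in \<open>F\<close>\<close>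

definition edge :: "2 \<Rightarrow> real \<Rightarrow> (real^2) set" where
  "edge i c = {x. x $ i = c \<and> (\<forall>j. 0 \<le> x $ j \<and> x $ j \<le> 1)}"

lemma convex_edge: "convex (edge i c)"
proof -
  have "edge i c = {x. x $ i = c} \<inter> cbox 0 1"
    by (auto simp: edge_def mem_box_cart)
  moreover have "convex {x :: real^2. x $ i = c}"
    by (rule convexI) (simp flip: distrib_right)
  ultimately show ?thesis
    by (simp add: convex_Int)
qed

lemma compact_F_Int_line: "compact {x \<in> F. x $ i = c}"
proof -
  have "closed {x :: real^2. x $ i = c}"
    by (intro closed_Collect_eq continuous_intros)
  then show ?thesis
    using compact_Int_closed[OF compact_F, of "{x. x $ i = c}"] by (simp add: Int_def)
qed

text \<open>On a side the digit in direction \<open>i\<close> is forced, so the trace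
  \<open>K\<close> of \<open>F\<close> is closed under those expansions
  \<open>t \<mapsto> n t - d\<close> whose value lies in the open unit interval. Blowing up an
  interval in \<open>K\<close> fills the side.\<close>

lemma edge_dichotomy:
  assumes ij: "i \<noteq> j" and c: "c = 0 \<or> c = 1"
    and int: "interior ((\<lambda>x. x $ j) ` {x \<in> F. x $ i = c}) \<noteq> {}"
  shows "edge i c \<subseteq> F"
proof -
  define K where "K = (\<lambda>x. x $ j) ` {x \<in> F. x $ i = c}"
  have "compact K"
    unfolding K_def by (intro compact_continuous_image compact_F_Int_line continuous_intros)
  have step: "real n * t - of_int d \<in> K"
    if t: "t \<in> K" "0 < real n * t - of_int d" "real n * t - of_int d < 1" for t d
  proof -
    obtain x where x: "x \<in> F" "x $ i = c" "x $ j = t"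
      using t(1) by (auto simp: K_def)
    obtain f e where fe: "f \<in> F" "e \<in> D" "real n *\<^sub>R x = f + int_point e"
      using F_self_similar[OF x(1)] .
    have comp: "real n * x $ k = f $ k + int_point e $ k" for k
      using arg_cong[OF fe(3), of "\<lambda>v. v $ k"] by simp
    have "f $ i = c"
      using comp[of i] c unit_square[OF fe(1), of i] digit_bounds[OF fe(2), of i] x(2) by auto
    moreover have "int_point e $ j - of_int d = 0"
    proof (rule int_less_1_eq_0)
      show "\<bar>int_point e $ j - of_int d\<bar> < 1"
        using comp[of j] t unit_square[OF fe(1), of j] unfolding x(3) by linarith
    qed simp
    ultimately have "f \<in> {x \<in> F. x $ i = c}" "f $ j = real n * t - of_int d"
      using fe comp[of j] x by auto
    then show ?thesis
      unfolding K_def using imageI[of f _ "\<lambda>x. x $ j"] by simp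
  qed
  have iter: "real n ^ k * t - of_int d \<in> K"
    if t: "t \<in> K" "0 < real n ^ k * t - of_int d" "real n ^ k * t - of_int d < 1" for t d k
    using t(2,3)
  proof (induction k arbitrary: d)
    case 0
    have "0 \<le> t" "t \<le> 1"
      using t(1) unit_square by (auto simp: K_def)
    then have "\<bar>real_of_int d\<bar> < 1"
      using 0 by auto
    then have "d = 0"
      by linarith
    then show ?case
      using t(1) by simp
  next
    case (Suc k)
    define s where "s = real n ^ k * t"
    \<comment> \<open>The induction hypothesis needs a value strictly inside the unit interval; an
      integer \<open>s\<close> would make the next value an integer, too.\<close>
    have frac: "0 < frac s"
    proof (rule ccontr)
      assume "\<not> 0 < frac s"
      then have "s \<in> \<int>"
        by (metis frac_eq_0_iff frac_ge_0 less_le)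
      then have "real n * s - of_int d \<in> \<int>"
        by auto
      then show False
        using Suc.prems int_less_1_eq_0[of "real n * s - of_int d"] by (simp add: s_def mult.assoc)
    qed
    have "frac s \<in> K"
      using Suc.IH[of "\<lfloor>s\<rfloor>"] frac frac_lt_1[of s] by (simp add: s_def frac_def)
    moreover have "real n * frac s - of_int (d - int n * \<lfloor>s\<rfloor>) = real n ^ Suc k * t - of_int d"
      by (simp add: frac_def s_def algebra_simps)
    ultimately show ?case
      using step[of "frac s" "d - int n * \<lfloor>s\<rfloor>"] Suc.prems by (simp only:)
  qed
  obtain t0 e where e: "e > 0" "ball t0 e \<subseteq> K"
    using int unfolding K_def[symmetric] by (metis ex_in_conv mem_interior)
  obtain k where k: "real n ^ k > 2 / e"
    by (rule n_power_unbounded)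
  define N where "N = real n ^ k"
  have N: "N > 0" "2 < N * e"
    using k e n_ge by (auto simp: N_def field_simps)
  have "s \<in> K" if s: "0 < s" "s < 1" for s
  proof -
    define d where "d = \<lfloor>N * t0\<rfloor>"
    define t where "t = (of_int d + s) / N"
    have "\<bar>N * t - N * t0\<bar> < N * e"
      using N s floor_correct[of "N * t0"] by (simp add: t_def d_def) linarith
    then have "N * \<bar>t - t0\<bar> < N * e"
      using N by (simp add: abs_mult flip: right_diff_distrib)
    then have "t \<in> K"
      using e N by (auto simp: dist_real_def abs_minus_commute)
    moreover have "N * t - of_int d = s"
      using N by (simp add: t_def)
    ultimately show ?thesis
      using iter[of t k d] s by (simp add: N_def)
  qed
  then have "{0<..<1} \<subseteq> K"
    by auto
  then have "closure {0<..<1} \<subseteq> K"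
    using \<open>compact K\<close> by (intro closure_minimal compact_imp_closed)
  then have K01: "{0..1} \<subseteq> K"
    by simp
  show ?thesis
  proof
    fix x assume x: "x \<in> edge i c"
    then have "x $ j \<in> K"
      using K01 by (auto simp: edge_def)
    then obtain y where y: "y \<in> F" "y $ i = c" "y $ j = x $ j"
      by (auto simp: K_def)
    then have "y = x"
      using x ij exhaust_2[of i] exhaust_2[of j] by (auto simp: vec2_eq_iff edge_def)
    then show "x \<in> F"
      using y by simp
  qed
qed

lemma other_index: obtains j :: 2 where "i \<noteq> j"
  using exhaust_2[of i] by (metis zero_neq_one)

lemma edge_points:
  assumes "i \<noteq> j" "c = 0 \<or> c = 1"
  obtains p q where "p \<in> edge i c" "q \<in> edge i c" "q - p = axis j 1"
proof (rule that)
  show "c *\<^sub>R axis i 1 \<in> edge i c" "c *\<^sub>R axis i 1 + axis j 1 \<in> edge i c"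
    using assms by (auto simp: edge_def axis_def)
qed simp

section \<open>Continua in \<open>H\<close> that leave a cell\<close>

lemma det2_image_line_interior:
  assumes "c = 0 \<or> c = 1" and int: "interior (det2 u ` {x \<in> F. x $ i = c}) \<noteq> {}"
  obtains j where "i \<noteq> j" "det2 u (axis j 1) \<noteq> 0" "interior ((\<lambda>x. x $ j) ` {x \<in> F. x $ i = c}) \<noteq> {}"
proof -
  obtain j where ij: "i \<noteq> j"
    by (rule other_index)
  define E where "E = {x \<in> F. x $ i = c}"
  define \<kappa> where "\<kappa> = det2 u (axis j 1)"
  define \<mu> where "\<mu> = c * det2 u (axis i 1)"
  have det_eq: "det2 u x = \<kappa> * x $ j + \<mu>" if "x \<in> E" for x
  proof -
    have "x = c *\<^sub>R axis i 1 + (x $ j) *\<^sub>R axis j 1"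
      using that ij exhaust_2[of i] exhaust_2[of j] by (auto simp: E_def vec2_eq_iff axis_def)
    then have "det2 u x = det2 u (c *\<^sub>R axis i 1 + (x $ j) *\<^sub>R axis j 1)"
      by simp
    then show ?thesis
      unfolding det2_simps \<kappa>_def \<mu>_def by simp
  qed
  define V where "V = (\<lambda>t. \<kappa> * t + \<mu>) -` interior (det2 u ` E)"
  obtain y where y: "y \<in> interior (det2 u ` E)"
    using int unfolding E_def by blast
  have "\<kappa> \<noteq> 0"
  proof
    assume "\<kappa> = 0"
    then have "det2 u ` E \<subseteq> {\<mu>}"
      using det_eq by auto
    then show False
      using y interior_mono[of "det2 u ` E" "{\<mu>}"] by auto
  qed
  have "open V"
    unfolding V_def by (intro open_vimage open_interior continuous_intros)
  moreover have "V \<subseteq> (\<lambda>x. x $ j) ` E"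
  proof
    fix t assume "t \<in> V"
    then have "\<kappa> * t + \<mu> \<in> det2 u ` E"
      using interior_subset unfolding V_def by blast
    then obtain x where "x \<in> E" "\<kappa> * t + \<mu> = \<kappa> * x $ j + \<mu>"
      using det_eq by auto
    then show "t \<in> (\<lambda>x. x $ j) ` E"
      using \<open>\<kappa> \<noteq> 0\<close> by auto
  qed
  moreover have "(y - \<mu>) / \<kappa> \<in> V"
    using y \<open>\<kappa> \<noteq> 0\<close> by (simp add: V_def)
  ultimately have "interior ((\<lambda>x. x $ j) ` E) \<noteq> {}"
    using interior_maximal by blast
  then show thesis
    using that ij \<open>\<kappa> \<noteq> 0\<close> unfolding E_def \<kappa>_def by blast
qed

text \<open>Otherwise the component of \<open>a\<close> in the part of \<open>C\<close> inside the cell would lie in a subset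
  that is open and closed in \<open>C\<close>.\<close>

lemma connected_touches_boundary:
  assumes C: "continuum C" and a: "a \<in> C" "a - int_point z \<in> F"
    and not_in: "\<not> C \<subseteq> (+) (int_point z) ` F"
  obtains K b where "connected K" "a \<in> K" "b \<in> K" "K \<subseteq> (+) (int_point z) ` F"
    "\<exists>i. (b - int_point z) $ i = 0 \<or> (b - int_point z) $ i = 1"
proof -
  define Q where "Q = (\<Inter>i. {p. 0 < (p - int_point z) $ i} \<inter> {p. (p - int_point z) $ i < 1})"
  have "open Q"
    unfolding Q_def
    by (intro open_INT ballI open_Int open_Collect_less continuous_intros) auto
  define C' where "C' = C \<inter> (+) (int_point z) ` F"
  have compC': "compact C'"
    unfolding C'_def using C compact_F
    by (intro compact_Int_closed compact_imp_closed compact_translation) (auto simp: continuum_def)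
  have aC': "a \<in> C'"
    using a by (auto simp: C'_def image_iff intro!: bexI[of _ "a - int_point z"])
  define K where "K = connected_component_set C' a"
  have K: "K \<in> components C'" "a \<in> K" "connected K" "K \<subseteq> C'"
    using aC' by (auto simp: K_def componentsI connected_component_subset)
  have "\<not> K \<subseteq> Q"
  proof
    assume KQ: "K \<subseteq> Q"
    have "locally compact C'"
      using compC' by (intro closed_imp_locally_compact compact_imp_closed)
    moreover have "compact K"
      using compC' K(1) by (rule compact_components)
    \<comment> \<open>The Sura-Bura theorem: a compact component inside an open set has a compact,
      relatively open neighbourhood in it.\<close>
    ultimately obtain N where N: "openin (top_of_set C') N" "compact N" "K \<subseteq> N" "N \<subseteq> Q"
      using Sura_Bura_clopen_subset[OF _ K(1) _ \<open>open Q\<close> KQ] by metis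
    obtain V where V: "open V" "N = C' \<inter> V"
      using N(1) by (auto simp: openin_open)
    \<comment> \<open>Inside the open cell \<open>H\<close> agrees with the translate of
      \<open>F\<close>, so \<open>N\<close> is relatively open in all of \<open>C\<close>, not only
      in \<open>C'\<close>.\<close>
    have "N = C \<inter> (V \<inter> Q)"
    proof
      show "N \<subseteq> C \<inter> (V \<inter> Q)"
        using V N by (auto simp: C'_def)
      show "C \<inter> (V \<inter> Q) \<subseteq> N"
      proof
        fix p assume p: "p \<in> C \<inter> (V \<inter> Q)"
        then have "p - int_point z \<in> F"
          using C by (intro H_in_open_cell) (auto simp: Q_def continuum_def)
        then have "p \<in> (+) (int_point z) ` F"
          by (intro image_eqI[of _ _ "p - int_point z"]) auto
        then show "p \<in> N"
          using p V by (auto simp: C'_def)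
      qed
    qed
    then have "openin (top_of_set C) N"
      using V \<open>open Q\<close> by (auto intro: openin_open_Int)
    moreover have "closedin (top_of_set C) N"
      using N(2) \<open>N = C \<inter> (V \<inter> Q)\<close> by (auto intro: closed_subset compact_imp_closed)
    ultimately have "N = {} \<or> N = C"
      using C unfolding continuum_def connected_clopen by blast
    then have "C \<subseteq> N"
      using K(2) N(3) by blast
    then show False
      using not_in V by (auto simp: C'_def)
  qed
  then obtain b where b: "b \<in> K" "b \<notin> Q" by blast
  then obtain f where f: "f \<in> F" "b = int_point z + f"
    using K(4) by (auto simp: C'_def)
  have "\<exists>i. (b - int_point z) $ i = 0 \<or> (b - int_point z) $ i = 1"
  proof (rule ccontr)
    assume "\<nexists>i. (b - int_point z) $ i = 0 \<or> (b - int_point z) $ i = 1"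
    then have "f $ i \<noteq> 0 \<and> f $ i \<noteq> 1" for i
      using f(2) by auto
    then have "0 < f $ i \<and> f $ i < 1" for i
      using unit_square[OF f(1), of i] by (auto simp: less_le)
    then show False
      using b(2) f(2) by (auto simp: Q_def)
  qed
  then show thesis
    using that K b by (auto simp: C'_def)
qed

lemma connected_translate_back:
  assumes "connected K" "K \<subseteq> (+) v ` F" "a \<in> K" "b \<in> K"
  obtains S where "connected S" "S \<subseteq> F" "a - v \<in> S" "b - v \<in> S"
proof
  show "connected ((\<lambda>x. x - v) ` K)"
    using assms(1) by (intro connected_continuous_image continuous_intros)
qed (use assms in auto)

text \<open>\<open>det2 u\<close> is constant on connected subsets of a translate of
  \<open>F\<close>. If it varied on \<open>C\<close>, each point of \<open>C\<close> would be joined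
  within its cell to a side, so that countably many translates of the images of the four traces
  would cover an interval. By Baire's theorem one image has interior, and \<open>F\<close> contains
  a side not parallel to \<open>u\<close>.\<close>

lemma continuum_parallel:
  assumes u: "\<And>S x y. connected S \<Longrightarrow> S \<subseteq> F \<Longrightarrow> x \<in> S \<Longrightarrow> y \<in> S \<Longrightarrow> det2 u (y - x) = 0"
    and C: "continuum C" "x \<in> C" "y \<in> C"
  shows "det2 u (y - x) = 0"
proof (rule ccontr)
  assume xy: "det2 u (y - x) \<noteq> 0"
  have const: "det2 u a = det2 u b" if "connected K" "K \<subseteq> (+) v ` F" "a \<in> K" "b \<in> K" for K v a b
    using connected_translate_back[OF that] u[of _ "a - v" "b - v"] by (metis det2_diff_right
        right_minus_eq diff_add_cancel add_diff_cancel)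
  define B where "B = (\<lambda>(i, c). det2 u ` {f \<in> F. f $ i = c}) ` (UNIV \<times> {0, 1})"
  define \<G> where "\<G> = (\<lambda>z. (+) (det2 u (int_point z)) ` (\<Union>B)) ` UNIV"
  have clB: "compact T" if "T \<in> B" for T
    using that unfolding B_def
    by (auto intro!: compact_continuous_image compact_F_Int_line continuous_intros)
  have finB: "finite B"
    unfolding B_def by simp
  have "det2 u ` C \<subseteq> \<Union>\<G>"
  proof
    fix t assume "t \<in> det2 u ` C"
    then obtain a where a: "a \<in> C" "t = det2 u a" by auto
    then have "a \<in> H"
      using C by (auto simp: continuum_def)
    then obtain z where z: "a - int_point z \<in> F"
      unfolding in_H_iff ..
    have "\<not> C \<subseteq> (+) (int_point z) ` F"
      using const[of C _ x y] C xy by (auto simp: continuum_def det2_diff_right)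
    then obtain K b where K: "connected K" "a \<in> K" "b \<in> K" "K \<subseteq> (+) (int_point z) ` F"
      and b: "\<exists>i. (b - int_point z) $ i = 0 \<or> (b - int_point z) $ i = 1"
      using connected_touches_boundary[OF C(1) a(1) z] by metis
    have "t = det2 u b"
      using const K a by metis
    also have "\<dots> = det2 u (int_point z) + det2 u (b - int_point z)"
      by (simp add: det2_diff_right)
    also have "\<dots> \<in> \<Union>\<G>"
    proof -
      have "b - int_point z \<in> F"
        using K by auto
      moreover obtain i c where "c \<in> {0, 1}" "(b - int_point z) $ i = c"
        using b by blast
      ultimately have "det2 u (b - int_point z) \<in> (\<lambda>(i, c). det2 u ` {f \<in> F. f $ i = c}) (i, c)"
        "(i, c) \<in> UNIV \<times> {0, 1}"
        by auto
      then have "det2 u (b - int_point z) \<in> \<Union>B"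
        unfolding B_def by blast
      then show ?thesis
        unfolding \<G>_def by blast
    qed
    finally show "t \<in> \<Union>\<G>" .
  qed
  moreover have "interior (det2 u ` C) \<noteq> {}"
  proof -
    have conn: "connected (det2 u ` C)"
      using C by (intro connected_continuous_image continuous_intros) (auto simp: continuum_def)
    define s t where "s = min (det2 u x) (det2 u y)" and "t = max (det2 u x) (det2 u y)"
    have "s < t"
      using xy by (auto simp: s_def t_def det2_diff_right)
    moreover have "{s..t} \<subseteq> det2 u ` C"
      using C by (intro connected_contains_Icc[OF conn]) (auto simp: s_def t_def min_def max_def)
    ultimately show ?thesis
      using interior_mono[of "{s..t}" "det2 u ` C"] by fastforce
  qed
  ultimately have ne: "interior (\<Union>\<G>) \<noteq> {}"
    using interior_mono by blast
  have compB: "compact (\<Union>B)"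
    using finB clB by (rule compact_Union)
  have cl: "closed T" if "T \<in> \<G>" for T
    using that compB unfolding \<G>_def by (auto intro!: compact_imp_closed compact_translation simp del: Union_iff)
  have "countable \<G>"
    unfolding \<G>_def by simp
  then obtain T where T: "T \<in> \<G>" "interior T \<noteq> {}"
    using cl ne by (rule countable_closed_cover_interior)
  then have neB: "interior (\<Union>B) \<noteq> {}"
    unfolding \<G>_def by (auto simp: interior_translation)
  have clB': "closed T" if "T \<in> B" for T
    using clB[OF that] by (rule compact_imp_closed)
  obtain T where T: "T \<in> B" "interior T \<noteq> {}"
    using countable_finite[OF finB] clB' neB by (rule countable_closed_cover_interior)
  then obtain i c where c: "c = 0 \<or> c = 1" "interior (det2 u ` {f \<in> F. f $ i = c}) \<noteq> {}"
    unfolding B_def by auto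
  then obtain j where j: "i \<noteq> j" "det2 u (axis j 1) \<noteq> 0"
    "interior ((\<lambda>x. x $ j) ` {x \<in> F. x $ i = c}) \<noteq> {}"
    by (rule det2_image_line_interior)
  have "edge i c \<subseteq> F"
    by (rule edge_dichotomy[OF j(1) c(1) j(3)])
  moreover obtain p q where "p \<in> edge i c" "q \<in> edge i c" "q - p = axis j 1"
    using edge_points[OF j(1) c(1)] .
  ultimately show False
    using u[of "edge i c" p q] j(2) convex_connected[OF convex_edge] by auto
qed

section \<open>Lines in \<open>H\<close> and the cells they enter\<close>

text \<open>The line is a limit of integer translates of the segments \<open>n\<^sup>k [x, y]\<close>.\<close>

lemma blowup_line:
  assumes seg: "closed_segment x y \<subseteq> F"
  shows "\<exists>c. \<forall>t. c + t *\<^sub>R (y - x) \<in> H"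
proof -
  define u where "u = y - x"
  \<comment> \<open>From the midpoint the dilated segment reaches \<open>real n ^ k / 2\<close>
    multiples of \<open>u\<close> both ways. Subtracting integer parts keeps the dilated midpoints
    in the unit square, where a subsequence converges.\<close>
  define m where "m = (1 / 2) *\<^sub>R (x + y)"
  define z where "z k = (\<lfloor>((real n ^ k) *\<^sub>R m) $ 1\<rfloor>, \<lfloor>((real n ^ k) *\<^sub>R m) $ 2\<rfloor>)" for k
  define w where "w k = (real n ^ k) *\<^sub>R m - int_point (z k)" for k
  have "w k \<in> cbox 0 1" for k
    unfolding mem_box_cart
  proof
    fix i
    have "of_int \<lfloor>v\<rfloor> \<le> v \<and> v - of_int \<lfloor>v\<rfloor> \<le> 1" for v :: real
      by linarith
    then show "(0 :: real^2) $ i \<le> w k $ i \<and> w k $ i \<le> (1 :: real^2) $ i"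
      using exhaust_2[of i] by (auto simp: w_def z_def simp del: vector_scaleR_component)
  qed
  then obtain c r where r: "strict_mono r" "(w \<circ> r) \<longlonglongrightarrow> c"
    using compact_cbox[of "0 :: real^2" 1] unfolding compact_def by metis
  have "c + t *\<^sub>R u \<in> H" for t
  proof (rule Lim_in_closed_set[OF closed_H])
    show "(\<lambda>k. (w \<circ> r) k + t *\<^sub>R u) \<longlonglongrightarrow> c + t *\<^sub>R u"
      by (intro tendsto_intros r)
    obtain k0 where k0: "real n ^ k0 > 2 * \<bar>t\<bar>"
      by (rule n_power_unbounded)
    have "(w \<circ> r) k + t *\<^sub>R u \<in> H" if "k \<ge> k0" for k
    proof -
      have "k0 \<le> r k"
        using that seq_suble[OF r(1), of k] by simp
      then have "real n ^ k0 \<le> real n ^ r k"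
        using n_ge by (intro power_increasing) auto
      then have N: "2 * \<bar>t\<bar> < real n ^ r k"
        using k0 by linarith
      define s where "s = t / real n ^ r k"
      have s: "\<bar>s\<bar> \<le> 1 / 2"
        using N by (simp add: s_def abs_divide divide_le_eq)
      have "m + s *\<^sub>R u = (1 - (1 / 2 + s)) *\<^sub>R x + (1 / 2 + s) *\<^sub>R y"
        by (simp add: m_def u_def algebra_simps flip: scaleR_add_left)
      then have "m + s *\<^sub>R u \<in> closed_segment x y"
        using s unfolding in_segment by (intro exI[of _ "1 / 2 + s"]) (auto simp: abs_le_iff)
      then have "(real n ^ r k) *\<^sub>R (m + s *\<^sub>R u) \<in> H"
        using seg F_subset_H by (intro expanding_power) auto
      then have in_H: "(real n ^ r k) *\<^sub>R (m + s *\<^sub>R u) + int_point (- z (r k)) \<in> H"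
        by (rule periodic)
      have Ns: "real n ^ r k * s = t"
        using n_ge by (simp add: s_def)
      have "(real n ^ r k) *\<^sub>R (m + s *\<^sub>R u) + int_point (- z (r k)) = (w \<circ> r) k + t *\<^sub>R u"
        by (simp add: w_def int_point_minus scaleR_add_right Ns)
      then show ?thesis
        using in_H by simp
    qed
    then show "\<forall>\<^sub>F k in sequentially. (w \<circ> r) k + t *\<^sub>R u \<in> H"
      by (auto simp: eventually_sequentially)
  qed simp
  then show ?thesis
    unfolding u_def by blast
qed

text \<open>\<open>p + t u\<close> lies in the interior of the unit cell with lower left corner \<open>z\<close> for all small
  \<open>t > 0\<close>.\<close>

definition enters :: "real^2 \<Rightarrow> real^2 \<Rightarrow> int \<times> int \<Rightarrow> bool" where
  "enters p u z \<longleftrightarrow> (\<forall>i. 0 \<le> (p - int_point z) $ i \<and> (p - int_point z) $ i \<le> 1 \<and>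
     ((p - int_point z) $ i = 0 \<longrightarrow> u $ i > 0) \<and> ((p - int_point z) $ i = 1 \<longrightarrow> u $ i < 0))"

text \<open>At an integer coordinate the two roundings select the cell on the side to which
  \<open>u\<close> points; at other coordinates \<open>\<lceil>p $ i\<rceil> - 1\<close> and
  \<open>\<lfloor>p $ i\<rfloor>\<close> agree.\<close>

definition next_cell :: "real^2 \<Rightarrow> real^2 \<Rightarrow> int \<times> int" where
  "next_cell p u = (let f = (\<lambda>i. if u $ i < 0 then \<lceil>p $ i\<rceil> - 1 else \<lfloor>p $ i\<rfloor>) in (f 1, f 2))"

lemma next_cell_component:
  "int_point (next_cell p u) $ i = of_int (if u $ i < 0 then \<lceil>p $ i\<rceil> - 1 else \<lfloor>p $ i\<rfloor>)"
  unfolding next_cell_def Let_def by (rule int_point_of_coords)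

text \<open>The line through \<open>p\<close> with direction \<open>u\<close> is not contained in a grid line.\<close>

definition off_grid :: "real^2 \<Rightarrow> real^2 \<Rightarrow> bool" where
  "off_grid p u \<longleftrightarrow> (\<forall>i. p $ i \<in> \<int> \<longrightarrow> u $ i \<noteq> 0)"

lemma off_grid_shift: "off_grid p u \<Longrightarrow> off_grid (p + t *\<^sub>R u) u"
  unfolding off_grid_def by force

text \<open>Only integer coordinates of \<open>p\<close> restrict the direction. Separating
  \<open>v\<close> from \<open>u\<close> allows one cell to serve two directions.\<close>

lemma enters_next_cell:
  assumes "off_grid p u" and sign: "\<And>i. p $ i \<in> \<int> \<Longrightarrow> u $ i * v $ i > 0"
  shows "enters p v (next_cell p u)"
  unfolding enters_def
proof
  fix i
  define e where "e = (p - int_point (next_cell p u)) $ i"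
  have e_eq: "e = p $ i - of_int (if u $ i < 0 then \<lceil>p $ i\<rceil> - 1 else \<lfloor>p $ i\<rfloor>)"
    unfolding e_def vector_minus_component next_cell_component ..
  have "0 \<le> e \<and> e \<le> 1 \<and> (e = 0 \<longrightarrow> v $ i > 0) \<and> (e = 1 \<longrightarrow> v $ i < 0)"
  proof (cases "u $ i < 0")
    case True
    then have e: "e = p $ i - of_int \<lceil>p $ i\<rceil> + 1"
      by (simp add: e_eq)
    have "v $ i < 0" if "e = 1"
    proof -
      have "p $ i = of_int \<lceil>p $ i\<rceil>"
        using that e by simp
      then have "u $ i * v $ i > 0"
        using sign Ints_of_int by metis
      then show ?thesis
        using True by (simp add: zero_less_mult_iff)
    qed
    moreover have "0 < e" "e \<le> 1"
      unfolding e by linarith+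
    ultimately show ?thesis by simp
  next
    case False
    then have e: "e = p $ i - of_int \<lfloor>p $ i\<rfloor>"
      by (simp add: e_eq)
    have "v $ i > 0" if "e = 0"
    proof -
      have "p $ i = of_int \<lfloor>p $ i\<rfloor>"
        using that e by simp
      then have "u $ i * v $ i > 0"
        using sign Ints_of_int by metis
      then show ?thesis
        using False by (simp add: zero_less_mult_iff)
    qed
    moreover have "0 \<le> e" "e < 1"
      unfolding e by linarith+
    ultimately show ?thesis by simp
  qed
  then show "0 \<le> (p - int_point (next_cell p u)) $ i \<and> (p - int_point (next_cell p u)) $ i \<le> 1 \<and>
    ((p - int_point (next_cell p u)) $ i = 0 \<longrightarrow> 0 < v $ i) \<and>
    ((p - int_point (next_cell p u)) $ i = 1 \<longrightarrow> v $ i < 0)"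
    unfolding e_def .
qed

text \<open>For small positive parameters the line is inside the open cell, where \<open>H\<close>
  is the translate of \<open>F\<close>; closedness adds the end points.\<close>

lemma initial_segment_in_F:
  assumes line: "\<And>t. p + t *\<^sub>R u \<in> H" and "enters p u z"
  obtains \<epsilon> where "\<epsilon> > 0" "closed_segment (p - int_point z) (p - int_point z + \<epsilon> *\<^sub>R u) \<subseteq> F"
proof -
  define q where "q = p - int_point z"
  have q: "0 \<le> q $ i" "q $ i \<le> 1" "q $ i = 0 \<Longrightarrow> u $ i > 0" "q $ i = 1 \<Longrightarrow> u $ i < 0" for i
    using assms(2) unfolding enters_def q_def by blast+
  have pos: "\<forall>\<^sub>F t in at_right 0. 0 < a + t * b"
    if "0 \<le> a" "a = 0 \<Longrightarrow> b > 0" for a b :: real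
  proof (cases "a = 0")
    case True
    then show ?thesis
      using that eventually_at_right_less[of "0::real"] by (auto elim: eventually_mono)
  next
    case False
    have "((\<lambda>t. a + t * b) \<longlongrightarrow> a + 0 * b) (at_right 0)"
      by (intro tendsto_intros)
    then show ?thesis
      using False that(1) by (intro order_tendstoD(1)[where y = "a + 0 * b"]) auto
  qed
  have "\<forall>\<^sub>F t in at_right 0. 0 < q $ i + t * u $ i \<and> q $ i + t * u $ i < 1" for i
    using eventually_conj[OF pos[of "q $ i" "u $ i"] pos[of "1 - q $ i" "- u $ i"]] q[of i]
    by (auto elim: eventually_mono)
  then have "\<forall>\<^sub>F t in at_right 0. \<forall>i. 0 < q $ i + t * u $ i \<and> q $ i + t * u $ i < 1"
    by (rule eventually_all_finite)
  then obtain \<epsilon> where \<epsilon>: "\<epsilon> > 0"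
    "\<And>t i. 0 < t \<Longrightarrow> t < \<epsilon> \<Longrightarrow> 0 < q $ i + t * u $ i \<and> q $ i + t * u $ i < 1"
    unfolding eventually_at_right_field by blast
  define S where "S = (\<lambda>t. q + t *\<^sub>R u) -` F"
  have "closed S"
    unfolding S_def using compact_F by (intro closed_vimage compact_imp_closed continuous_intros)
  moreover have "{0<..<\<epsilon>} \<subseteq> S"
  proof
    fix t assume t: "t \<in> {0<..<\<epsilon>}"
    have eq: "p + t *\<^sub>R u - int_point z = q + t *\<^sub>R u"
      by (simp add: q_def)
    have "p + t *\<^sub>R u - int_point z \<in> F"
      using t \<epsilon>(2)[of t] by (intro H_in_open_cell line; unfold eq) auto
    then show "t \<in> S"
      by (simp add: S_def eq)
  qed
  ultimately have "closure {0<..<\<epsilon>} \<subseteq> S"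
    by (intro closure_minimal)
  then have S: "{0..\<epsilon>} \<subseteq> S"
    using \<epsilon>(1) by simp
  have "closed_segment q (q + \<epsilon> *\<^sub>R u) \<subseteq> F"
  proof
    fix x assume "x \<in> closed_segment q (q + \<epsilon> *\<^sub>R u)"
    then obtain s where s: "0 \<le> s" "s \<le> 1" "x = (1 - s) *\<^sub>R q + s *\<^sub>R (q + \<epsilon> *\<^sub>R u)"
      unfolding in_segment by blast
    then have "x = q + (s * \<epsilon>) *\<^sub>R u"
      by (simp add: algebra_simps)
    moreover have "s * \<epsilon> \<in> {0..\<epsilon>}"
      using s \<epsilon>(1) by (simp add: mult_left_le_one_le)
    ultimately show "x \<in> F"
      using S by (auto simp: S_def)
  qed
  then show thesis
    using that \<epsilon>(1) by (simp add: q_def)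
qed

text \<open>The points of the line whose other coordinate is in the open unit interval are
  translates of points of \<open>F\<close> on two opposite sides. So two compact traces cover an
  interval, and one has interior by Baire's theorem.\<close>

lemma grid_line_edge:
  assumes line: "\<And>t. c + t *\<^sub>R u \<in> H" and "u \<noteq> 0" "u $ i = 0" "c $ i \<in> \<int>"
  shows "\<exists>d. (d = 0 \<or> d = 1) \<and> edge i d \<subseteq> F"
proof -
  obtain j where ij: "i \<noteq> j"
    by (rule other_index)
  then have uj: "u $ j \<noteq> 0"
    using assms(2,3) exhaust_2[of i] exhaust_2[of j] by (auto simp: vec2_eq_iff)
  define K where "K d = (\<lambda>x. x $ j) ` {x \<in> F. x $ i = d}" for d
  have "{0<..<1} \<subseteq> \<Union> {K 0, K 1}"
  proof
    fix t :: real assume t: "t \<in> {0<..<1}"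
    define x where "x = c + ((t - c $ j) / u $ j) *\<^sub>R u"
    have x: "x $ i = c $ i" "x $ j = t"
      using assms(3) uj by (simp_all add: x_def)
    have "x \<in> H"
      unfolding x_def by (rule line)
    then obtain z where z: "x - int_point z \<in> F"
      unfolding in_H_iff ..
    have "int_point z $ j = 0"
    proof (rule int_less_1_eq_0)
      show "\<bar>int_point z $ j\<bar> < 1"
        using unit_square[OF z, of j] t x(2) by auto
    qed simp
    moreover have "(x - int_point z) $ i = 0 \<or> (x - int_point z) $ i = 1"
    proof -
      have "(x - int_point z) $ i \<in> \<int>"
        using x(1) assms(4) by simp
      then obtain k :: int where k: "(x - int_point z) $ i = of_int k"
        by (rule Ints_cases)
      then have "k = 0 \<or> k = 1"
        using unit_square[OF z, of i] by auto
      then show ?thesis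
        using k by auto
    qed
    ultimately show "t \<in> \<Union> {K 0, K 1}"
      using z x(2) unfolding K_def by (auto intro!: image_eqI[of _ _ "x - int_point z"])
  qed
  then have ne: "interior (\<Union> {K 0, K 1}) \<noteq> {}"
    using interior_mono[of "{0<..<1}" "\<Union> {K 0, K 1}"] by fastforce
  have cl: "closed T" if "T \<in> {K 0, K 1}" for T
    using that unfolding K_def
    by (auto intro!: compact_imp_closed compact_continuous_image compact_F_Int_line continuous_intros)
  have "countable {K 0, K 1}"
    by simp
  then obtain T where "T \<in> {K 0, K 1}" "interior T \<noteq> {}"
    using cl ne by (rule countable_closed_cover_interior)
  then obtain d where "d = 0 \<or> d = 1" "interior (K d) \<noteq> {}"
    by auto
  then show ?thesis
    using edge_dichotomy[OF ij] unfolding K_def by blast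
qed

section \<open>Fractal squares whose connected subsets are all collinear\<close>

context
  assumes collinear_connected: "\<And>S. connected S \<Longrightarrow> S \<subseteq> F \<Longrightarrow> collinear S"
begin

lemma overlapping_parallel:
  assumes A: "connected A" "A \<subseteq> F" "a \<in> A" "a' \<in> A" and B: "connected B" "B \<subseteq> F" "b \<in> B" "b' \<in> B"
    and "A \<inter> B \<noteq> {}"
  shows "det2 (a' - a) (b' - b) = 0"
proof -
  have "collinear (A \<union> B)"
    using assms by (intro collinear_connected connected_Un) auto
  then obtain u where u: "\<And>x y. x \<in> A \<union> B \<Longrightarrow> y \<in> A \<union> B \<Longrightarrow> \<exists>c. x - y = c *\<^sub>R u"
    unfolding collinear_def by blast
  obtain k where "a' - a = k *\<^sub>R u"
    using u[of a' a] A by auto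
  moreover obtain l where "b' - b = l *\<^sub>R u"
    using u[of b' b] B by auto
  ultimately show ?thesis
    by (simp add: det2_simps)
qed

lemma parallel_if_enter_same_cell:
  assumes "\<And>t. p + t *\<^sub>R u \<in> H" "\<And>t. p + t *\<^sub>R v \<in> H" "enters p u z" "enters p v z"
  shows "det2 u v = 0"
proof -
  obtain \<epsilon> where \<epsilon>: "\<epsilon> > 0" "closed_segment (p - int_point z) (p - int_point z + \<epsilon> *\<^sub>R u) \<subseteq> F"
    using assms(1,3) by (rule initial_segment_in_F)
  obtain \<delta> where \<delta>: "\<delta> > 0" "closed_segment (p - int_point z) (p - int_point z + \<delta> *\<^sub>R v) \<subseteq> F"
    using assms(2,4) by (rule initial_segment_in_F)
  have "det2 ((p - int_point z + \<epsilon> *\<^sub>R u) - (p - int_point z))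
      ((p - int_point z + \<delta> *\<^sub>R v) - (p - int_point z)) = 0"
    by (rule overlapping_parallel[OF connected_segment(1) \<epsilon>(2) _ _ connected_segment(1) \<delta>(2)]) auto
  then show ?thesis
    using \<epsilon> \<delta> by (simp add: det2_scaleR_left det2_scaleR_right)
qed

text \<open>If \<open>u $ i * v $ i\<close> is positive at all integer coordinates of
  \<open>p\<close>, then \<open>u\<close> and \<open>v\<close> enter the same cell; if it is
  negative at all of them, \<open>u\<close> and \<open>- v\<close> do. So both signs occur, which
  takes two integer coordinates.\<close>

lemma off_grid_lines_meet_at_vertex:
  assumes u: "\<And>t. p + t *\<^sub>R u \<in> H" "off_grid p u" and v: "\<And>t. p + t *\<^sub>R v \<in> H" "off_grid p v"
    and det: "det2 u v \<noteq> 0"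
  shows "p $ 1 \<in> \<int>" "p $ 2 \<in> \<int>" "(u $ 1 * v $ 1) * (u $ 2 * v $ 2) < 0"
proof -
  have no: False if r: "r = 1 \<or> r = - 1" "\<And>i. p $ i \<in> \<int> \<Longrightarrow> r * (u $ i * v $ i) > 0" for r
  proof -
    have "enters p u (next_cell p u)"
      using u(2) by (rule enters_next_cell) (use u(2) in \<open>auto simp: off_grid_def zero_less_mult_iff less_le\<close>)
    moreover have "enters p (r *\<^sub>R v) (next_cell p u)"
      using u(2) by (rule enters_next_cell) (use r(2) in \<open>auto simp: algebra_simps\<close>)
    moreover have "p + t *\<^sub>R (r *\<^sub>R v) \<in> H" for t
      using v(1)[of "t * r"] by simp
    ultimately have "det2 u (r *\<^sub>R v) = 0"
      using u(1) parallel_if_enter_same_cell by blast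
    then show False
      using det r(1) by (auto simp: det2_scaleR_right)
  qed
  define X where "X i = u $ i * v $ i" for i
  have "X i \<noteq> 0" if "p $ i \<in> \<int>" for i
    using u(2) v(2) that by (auto simp: off_grid_def X_def)
  then have nz: "X i > 0 \<or> X i < 0" if "p $ i \<in> \<int>" for i
    using that by (simp add: linorder_neq_iff disj_commute)
  have "\<not> (\<forall>i. p $ i \<in> \<int> \<longrightarrow> X i > 0)" "\<not> (\<forall>i. p $ i \<in> \<int> \<longrightarrow> X i < 0)"
    using no[of 1] no[of "- 1"] by (auto simp: X_def)
  then have "p $ 1 \<in> \<int> \<and> p $ 2 \<in> \<int> \<and> X 1 * X 2 < 0"
    using nz[of 1] nz[of 2] unfolding forall_2 mult_less_0_iff by linarith
  then show "p $ 1 \<in> \<int>" "p $ 2 \<in> \<int>" "(u $ 1 * v $ 1) * (u $ 2 * v $ 2) < 0"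
    unfolding X_def by blast+
qed

text \<open>A line with \<open>u $ i \<noteq> 0\<close> crosses the grid line where coordinate
  \<open>i\<close> is 0. From there an initial piece, translated into \<open>F\<close>, starts on
  \<open>edge i d\<close> without being parallel to it.\<close>

lemma edge_parallel_off_grid_line:
  assumes edge: "edge i d \<subseteq> F" "d = 0 \<or> d = 1" and line: "\<And>t. c + t *\<^sub>R u \<in> H" "off_grid c u"
  shows "u $ i = 0"
proof (rule ccontr)
  assume ui: "u $ i \<noteq> 0"
  obtain j where ij: "i \<noteq> j"
    by (rule other_index)
  define p where "p = c + (- c $ i / u $ i) *\<^sub>R u"
  have pi: "p $ i = 0"
    using ui by (simp add: p_def)
  \<comment> \<open>The orientation for which the entered cell has the crossing point on its lower
    side in direction \<open>i\<close> if \<open>d = 0\<close> and on its upper side if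
    \<open>d = 1\<close>.\<close>
  define r :: real where "r = (if (u $ i > 0) = (d = 0) then 1 else - 1)"
  have r: "r \<noteq> 0"
    by (simp add: r_def)
  have "off_grid p u"
    unfolding p_def using line(2) by (rule off_grid_shift)
  then have off: "off_grid p (r *\<^sub>R u)"
    using r by (simp add: off_grid_def)
  define z where "z = next_cell p (r *\<^sub>R u)"
  have "enters p (r *\<^sub>R u) z"
    unfolding z_def using off
    by (rule enters_next_cell) (use off in \<open>auto simp: off_grid_def zero_less_mult_iff less_le\<close>)
  moreover have "p + t *\<^sub>R (r *\<^sub>R u) \<in> H" for t
    using line(1)[of "- c $ i / u $ i + t * r"] by (simp add: p_def algebra_simps)
  ultimately obtain \<epsilon> where \<epsilon>: "\<epsilon> > 0"
    "closed_segment (p - int_point z) (p - int_point z + \<epsilon> *\<^sub>R (r *\<^sub>R u)) \<subseteq> F"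
    using initial_segment_in_F by blast
  have q: "p - int_point z \<in> F"
    using \<epsilon>(2) by auto
  moreover have "(p - int_point z) $ i = d"
    unfolding vector_minus_component z_def next_cell_component pi
    using ui edge(2) by (auto simp: r_def)
  ultimately have "p - int_point z \<in> edge i d"
    using unit_square[OF q] by (simp add: edge_def)
  then have ne: "edge i d \<inter> closed_segment (p - int_point z) (p - int_point z + \<epsilon> *\<^sub>R (r *\<^sub>R u)) \<noteq> {}"
    by auto
  obtain a b where ab: "a \<in> edge i d" "b \<in> edge i d" "b - a = axis j 1"
    using edge_points[OF ij edge(2)] .
  have "det2 (b - a) ((p - int_point z + \<epsilon> *\<^sub>R (r *\<^sub>R u)) - (p - int_point z)) = 0"
    by (rule overlapping_parallel[OF convex_connected[OF convex_edge] edge(1) ab(1,2)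
          connected_segment(1) \<epsilon>(2) _ _ ne]) auto
  then have "det2 (axis j 1) u = 0"
    using \<epsilon>(1) r by (simp add: ab(3) det2_scaleR_right)
  then show False
    using ui ij exhaust_2[of i] exhaust_2[of j] by (auto simp: det2_def axis_def)
qed

lemma not_two_edge_directions:
  assumes "i \<noteq> j" "edge i c \<subseteq> F" "edge j d \<subseteq> F" "c = 0 \<or> c = 1" "d = 0 \<or> d = 1"
  shows False
proof -
  have "c *\<^sub>R axis i 1 + d *\<^sub>R axis j 1 \<in> edge i c \<inter> edge j d"
    using assms by (auto simp: edge_def axis_def)
  then have ne: "edge i c \<inter> edge j d \<noteq> {}"
    by blast
  obtain p q where pq: "p \<in> edge i c" "q \<in> edge i c" "q - p = axis j 1"
    using edge_points[OF assms(1,4)] .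
  obtain p' q' where pq': "p' \<in> edge j d" "q' \<in> edge j d" "q' - p' = axis i 1"
    using edge_points[OF assms(1)[symmetric] assms(5)] .
  have "det2 (q - p) (q' - p') = 0"
    using convex_connected[OF convex_edge] assms pq pq' ne by (intro overlapping_parallel) auto
  then show False
    using assms(1) exhaust_2[of i] exhaust_2[of j] unfolding pq(3) pq'(3)
    by (auto simp: det2_def axis_def)
qed

text \<open>If the lines meet at a vertex, taken as the origin, then one of them has positive and the other
  negative slope. The translate of the second by \<open>(1, 0)\<close> meets the first line again at a vertex \<open>(m, l)\<close>,
  and the slopes force \<open>m (m - 1) < 0\<close>.\<close>

lemma off_grid_lines_parallel:
  assumes u: "\<And>t. c + t *\<^sub>R u \<in> H" "off_grid c u" and v: "\<And>t. d + t *\<^sub>R v \<in> H" "off_grid d v"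
  shows "det2 u v = 0"
proof (rule ccontr)
  assume det: "det2 u v \<noteq> 0"
  have meet: "\<exists>\<alpha> \<beta>. w = \<alpha> *\<^sub>R u + \<beta> *\<^sub>R v" for w
    using cramer2[OF det] by blast
  obtain \<alpha> \<beta> where "d - c = \<alpha> *\<^sub>R u + \<beta> *\<^sub>R v"
    using meet by blast
  then have p: "d + (- \<beta>) *\<^sub>R v = c + \<alpha> *\<^sub>R u"
    by (simp add: algebra_simps)
  define p where "p = c + \<alpha> *\<^sub>R u"
  have lu: "p + t *\<^sub>R u \<in> H" for t
    using u(1)[of "\<alpha> + t"] by (simp add: p_def algebra_simps)
  have lv: "p + t *\<^sub>R v \<in> H" for t
    using v(1)[of "- \<beta> + t"] unfolding p_def p[symmetric] by (simp add: algebra_simps)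
  have offu: "off_grid p u"
    unfolding p_def using u(2) by (rule off_grid_shift)
  have offv: "off_grid p v"
    unfolding p_def p[symmetric] using v(2) by (rule off_grid_shift)
  note vertex = off_grid_lines_meet_at_vertex[OF lu offu lv offv det]
  then obtain k l :: int where "p $ 1 = of_int k" "p $ 2 = of_int l"
    by (metis Ints_cases)
  then have "p = int_point (k, l)"
    by (simp add: vec2_eq_iff)
  then have lines0: "t *\<^sub>R u \<in> H" "t *\<^sub>R v \<in> H" for t
    using periodic[OF lu, of t "- (k, l)"] periodic[OF lv, of t "- (k, l)"]
    by (simp_all only: int_point_minus) simp_all
  have nz: "u $ 1 \<noteq> 0" "u $ 2 \<noteq> 0" "v $ 1 \<noteq> 0" "v $ 2 \<noteq> 0"
    using vertex(3) by auto
  then have off: "off_grid x u" "off_grid x v" for x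
    by (simp_all add: off_grid_def forall_2)
  \<comment> \<open>The point \<open>a *\<^sub>R u\<close> is where the line through the origin
    along \<open>u\<close> meets the line along \<open>v\<close> shifted by \<open>(1, 0)\<close>;
    it must be a vertex.\<close>
  obtain a b where "int_point (1, 0) = a *\<^sub>R u + b *\<^sub>R v"
    using meet by blast
  then have ab: "1 = a * u $ 1 + b * v $ 1" "0 = a * u $ 2 + b * v $ 2"
    and q: "a *\<^sub>R u = int_point (1, 0) + (- b) *\<^sub>R v"
    by (simp_all add: vec2_eq_iff)
  have l1: "a *\<^sub>R u + t *\<^sub>R u \<in> H" for t
    using lines0(1)[of "a + t"] by (simp add: scaleR_add_left)
  have l2: "a *\<^sub>R u + t *\<^sub>R v \<in> H" for t
    using periodic[OF lines0(2)[of "- b + t"], of "(1, 0)"] unfolding q by (simp add: algebra_simps)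
  have "(a *\<^sub>R u) $ 1 \<in> \<int>"
    using off_grid_lines_meet_at_vertex(1)[OF l1 off(1) l2 off(2) det] .
  then obtain m :: int where m: "a * u $ 1 = of_int m"
    by (auto elim: Ints_cases)
  have "b \<noteq> 0"
    using ab nz by auto
  then have "a \<noteq> 0"
    using ab nz by auto
  have "(a * b)\<^sup>2 * ((u $ 1 * v $ 1) * (u $ 2 * v $ 2)) = (a * u $ 1) * (b * v $ 1) * ((a * u $ 2) * (b * v $ 2))"
    by (simp add: power2_eq_square algebra_simps)
  also have "\<dots> = of_int m * (1 - of_int m) * - (a * u $ 2)\<^sup>2"
  proof -
    have "b * v $ 1 = 1 - of_int m" "b * v $ 2 = - (a * u $ 2)"
      using ab m by linarith+
    then show ?thesis
      by (simp add: m power2_eq_square)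
  qed
  finally have eq: "(a * b)\<^sup>2 * ((u $ 1 * v $ 1) * (u $ 2 * v $ 2)) = of_int (m * (m - 1)) * (a * u $ 2)\<^sup>2"
    by (simp add: algebra_simps)
  \<comment> \<open>No integer lies strictly between 0 and 1.\<close>
  have "m * (m - 1) \<ge> 0"
    by (cases "m \<le> 0") (auto simp: mult_nonpos_nonpos)
  then have "real_of_int (m * (m - 1)) \<ge> 0"
    by (simp only: of_int_0_le_iff)
  then have "of_int (m * (m - 1)) * (a * u $ 2)\<^sup>2 \<ge> 0"
    by (intro mult_nonneg_nonneg) auto
  moreover have "(a * b)\<^sup>2 * ((u $ 1 * v $ 1) * (u $ 2 * v $ 2)) < 0"
    using vertex(3) \<open>a \<noteq> 0\<close> \<open>b \<noteq> 0\<close> by (simp add: mult_pos_neg)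
  ultimately show False
    using eq by linarith
qed

text \<open>Each line either is off the grid or yields a side in \<open>F\<close> parallel to it, so
  the cases compare two lines, a line and a side, or two sides.\<close>

lemma lines_parallel:
  assumes u: "\<And>t. c + t *\<^sub>R u \<in> H" and v: "\<And>t. d + t *\<^sub>R v \<in> H"
  shows "det2 u v = 0"
proof (rule ccontr)
  assume det: "det2 u v \<noteq> 0"
  then have nz: "u \<noteq> 0" "v \<noteq> 0"
    by auto
  have edge_u: "\<exists>e. (e = 0 \<or> e = 1) \<and> edge i e \<subseteq> F" if "u $ i = 0" "c $ i \<in> \<int>" for i
    by (rule grid_line_edge[OF u nz(1) that])
  have edge_v: "\<exists>e. (e = 0 \<or> e = 1) \<and> edge i e \<subseteq> F" if "v $ i = 0" "d $ i \<in> \<int>" for i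
    by (rule grid_line_edge[OF v nz(2) that])
  have not_both: "\<not> (u $ i = 0 \<and> v $ i = 0)" for i
    using det exhaust_2[of i] by (auto simp: det2_def)
  show False
  proof (cases "off_grid c u")
    case True
    then have "\<not> off_grid d v"
      using off_grid_lines_parallel[OF u _ v] det by blast
    then obtain i e where i: "v $ i = 0" "e = 0 \<or> e = 1" "edge i e \<subseteq> F"
      using edge_v unfolding off_grid_def by blast
    then show False
      using edge_parallel_off_grid_line[OF i(3,2) u True] not_both by blast
  next
    case False
    then obtain i e where i: "u $ i = 0" "e = 0 \<or> e = 1" "edge i e \<subseteq> F"
      using edge_u unfolding off_grid_def by blast
    show False
    proof (cases "off_grid d v")
      case True
      then show False
        using edge_parallel_off_grid_line[OF i(3,2) v True] i(1) not_both by blast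
    next
      case False
      then obtain j e' where j: "v $ j = 0" "e' = 0 \<or> e' = 1" "edge j e' \<subseteq> F"
        using edge_v unfolding off_grid_def by blast
      then show False
        using not_two_edge_directions[OF _ i(3) j(3) i(2) j(2)] i(1) not_both by blast
    qed
  qed
qed

text \<open>Connected collinear sets are convex, so the chords are segments in \<open>F\<close>,
  which blow up to full lines in \<open>H\<close>.\<close>

lemma connected_subsets_parallel:
  assumes S: "connected S" "S \<subseteq> F" "x \<in> S" "y \<in> S" and T: "connected T" "T \<subseteq> F" "x' \<in> T" "y' \<in> T"
  shows "det2 (y - x) (y' - x') = 0"
proof -
  have "convex S" "convex T"
    using collinear_connected convex_connected_collinear S T by blast+
  then have seg: "closed_segment x y \<subseteq> F" "closed_segment x' y' \<subseteq> F"
    using S T closed_segment_subset by blast+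
  then show ?thesis
    using blowup_line[OF seg(1)] blowup_line[OF seg(2)] lines_parallel by blast
qed

text \<open>A connected subset of \<open>F\<close> with two points prescribes the direction
  \<open>u\<close>, which is arbitrary if there is none; \<open>continuum_parallel\<close> extends
  it to all continua in \<open>H\<close>.\<close>

lemma not_transversal: "\<not> transversal_continua"
proof -
  obtain u where u: "u \<noteq> 0"
    "\<And>S x y. connected S \<Longrightarrow> S \<subseteq> F \<Longrightarrow> x \<in> S \<Longrightarrow> y \<in> S \<Longrightarrow> det2 u (y - x) = 0"
  proof (cases "\<exists>S x y. connected S \<and> S \<subseteq> F \<and> x \<in> S \<and> y \<in> S \<and> x \<noteq> y")
    case True
    then obtain S x y where S: "connected S" "S \<subseteq> F" "x \<in> S" "y \<in> S" "x \<noteq> y"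
      by blast
    show thesis
      using that[of "y - x"] connected_subsets_parallel[OF S(1-4)] S(5) by auto
  next
    case False
    show thesis
    proof (rule that)
      show "axis 1 1 \<noteq> (0 :: real^2)"
        by (simp add: axis_eq_0_iff)
      show "det2 (axis 1 1) (y - x) = 0" if "connected S" "S \<subseteq> F" "x \<in> S" "y \<in> S" for S x y
      proof -
        have "x = y"
          using False that by blast
        then show ?thesis
          by simp
      qed
    qed
  qed
  have "det2 (q - p) (r - p') = 0"
    if C: "continuum C" "continuum C'" and mem: "p \<in> C" "q \<in> C" "p' \<in> C'" "r \<in> C'" for C C' p q p' r
  proof -
    have "det2 u (q - p) = 0" "det2 u (r - p') = 0"
      using continuum_parallel[OF u(2) C(1) mem(1,2)] continuum_parallel[OF u(2) C(2) mem(3,4)] by auto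
    then obtain k l where "q - p = k *\<^sub>R u" "r - p' = l *\<^sub>R u"
      using parallel_if_det2_eq_0[OF _ u(1)] by metis
    then show ?thesis
      by (simp add: det2_simps)
  qed
  then show ?thesis
    unfolding transversal_continua_def by blast
qed

end

section \<open>Components of \<open>F\<close>\<close>

lemma component_continuum:
  assumes "C \<in> components F"
  shows "continuum C"
  unfolding continuum_def
  using assms compact_F F_subset_H in_components_subset[OF assms]
  by (auto intro: compact_components in_components_connected)

lemma nontrivial_component_segment:
  assumes "\<not> transversal_continua" and C: "C \<in> nontrivial_components F"
  obtains a b where "a \<noteq> b" "C = closed_segment a b"
proof -
  have "continuum C" "C \<noteq> {}"
    using C component_continuum by (auto simp: nontrivial_components_def)
  then obtain a b where "C = closed_segment a b"
    using collinear_continuum[OF assms(1)] compact_convex_collinear_segment_alt[of C]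
    unfolding continuum_def by blast
  moreover from this have "a \<noteq> b"
    using C by (auto simp: nontrivial_components_def)
  ultimately show thesis
    using that by blast
qed

lemma parallel_components:
  assumes nt: "\<not> transversal_continua"
  shows "parallel_line_segments (nontrivial_components F)"
proof (cases "nontrivial_components F = {}")
  case True
  \<comment> \<open>With no non-trivial component any non-zero direction serves.\<close>
  have "axis 1 1 \<noteq> (0 :: real^2)"
    by (simp add: axis_eq_0_iff)
  then show ?thesis
    unfolding parallel_line_segments_def True by blast
next
  case False
  then obtain C where C: "C \<in> nontrivial_components F"
    by blast
  then obtain a b where ab: "a \<noteq> b" "C = closed_segment a b"
    using nontrivial_component_segment[OF nt] by blast
  have "\<exists>a' b'. a' \<noteq> b' \<and> S = closed_segment a' b' \<and> (\<exists>c. b' - a' = c *\<^sub>R (b - a))"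
    if S: "S \<in> nontrivial_components F" for S
  proof -
    obtain a' b' where ab': "a' \<noteq> b'" "S = closed_segment a' b'"
      using nontrivial_component_segment[OF nt S] .
    have "continuum C" "continuum S"
      using C S component_continuum by (auto simp: nontrivial_components_def)
    then have "det2 (b - a) (b' - a') = 0"
      using nt ab ab' unfolding transversal_continua_def by (metis ends_in_segment)
    then obtain c where "b' - a' = c *\<^sub>R (b - a)"
      using parallel_if_det2_eq_0[of "b - a"] ab(1) by auto
    then show ?thesis
      using ab' by blast
  qed
  then show ?thesis
    unfolding parallel_line_segments_def using ab(1) by (intro exI[of _ "b - a"]) auto
qed

text \<open>A connected subset of \<open>F\<close> lies in one component, a point or a segment, so
  it is collinear.\<close>

lemma not_transversal_if_segments:
  assumes seg: "\<forall>C\<in>nontrivial_components F. line_segment C"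
  shows "\<not> transversal_continua"
proof (rule not_transversal)
  fix S :: "(real^2) set" assume S: "connected S" "S \<subseteq> F"
  show "collinear S"
  proof (cases "S = {}")
    case False
    then obtain x where x: "x \<in> S" by blast
    define C where "C = connected_component_set F x"
    have C: "C \<in> components F"
      using x S unfolding C_def by (intro componentsI) auto
    have SC: "S \<subseteq> C"
      unfolding C_def using x S by (intro connected_component_maximal)
    show ?thesis
    proof (cases "C \<in> nontrivial_components F")
      case True
      then show ?thesis
        using seg SC collinear_subset[OF collinear_closed_segment] unfolding line_segment_def by metis
    next
      case False
      then have "S \<subseteq> {x}"
        using C SC x by (auto simp: nontrivial_components_def)
      then show ?thesis
        using collinear_subset[OF collinear_sing] by blast
    qed
  qed auto
qed

end

theorem theorem1p1:
  fixes n :: nat and D :: "(int \<times> int) set" and F H :: "(real^2) set"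
  assumes "fractal_square n D F"
    and "H = periodic_extension F"
  shows
    "((\<exists>C\<in>components (- H). bounded C) \<and> \<not> (\<exists>C\<in>components (- H). \<not> bounded C) \<or>
      (\<exists>C\<in>components (- H). \<not> bounded C) \<and> \<not> (\<exists>C\<in>components (- H). bounded C)) \<and>
     ((\<exists>C\<in>components (- H). bounded C) \<longleftrightarrow>
      (\<exists>C\<in>nontrivial_components F. \<not> line_segment C)) \<and>
     ((\<exists>C\<in>components (- H). \<not> bounded C) \<longrightarrow>
      totally_disconnected F \<or> parallel_line_segments (nontrivial_components F))"
proof -
  interpret fractal_square_set n D F
    by standard (rule assms(1))
  have ne: "\<exists>C. C \<in> components (- H)"
    using H_ne_UNIV components_eq_empty unfolding assms(2) by blast
  \<comment> \<open>\<open>transversal_continua\<close> makes all components of the complement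
    bounded, its negation makes all of them unbounded. As there is at least one component, exactly
    one alternative holds.\<close>
  show ?thesis
  proof (cases transversal_continua)
    case True
    then have "\<forall>C\<in>components (- H). bounded C"
      unfolding assms(2) using bounded_components_if_transversal by blast
    moreover have "\<exists>C\<in>nontrivial_components F. \<not> line_segment C"
      using True not_transversal_if_segments by blast
    ultimately show ?thesis
      using ne by blast
  next
    case False
    then have "\<forall>C\<in>components (- H). \<not> bounded C"
      unfolding assms(2) using unbounded_components_if_not_transversal by blast
    moreover have "\<forall>C\<in>nontrivial_components F. line_segment C"
      unfolding line_segment_def using nontrivial_component_segment[OF False] by metis
    ultimately show ?thesis
      using ne parallel_components[OF False] by blast
  qed
qed

end
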